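(* For any CQ ${\boldsymbol q}(\vec{x})$ and ontology $\mathcal{T}$, the formula ${\boldsymbol q}^\dagger(\vec{x})$ (for any choice of the variables $z$ in its recursive construction) is a PE-rewriting of ${\boldsymbol q}$ and $\mathcal{T}$ over complete data.
   Context: Ontologies are finite sets of tgds $\forall\vec x(\varphi(\vec x)\to\exists\vec y\bigwedge_i\psi_i(\vec x,\vec y))$ with unary/binary atoms, no constants, $|\vec x\cup\vec y|\le2$. A data instance is complete if it contains every ground atom over its constants that it entails together with $\mathcal{T}$. A PE-rewriting over complete data of ${\boldsymbol q}(\vec x)$ is a positive existential formula ${\boldsymbol q}'(\vec x)$ without constants with $\mathcal{T},\mathcal{A}\models{\boldsymbol q}(\vec a)$ iff $\mathcal{A}\models{\boldsymbol q}'(\vec a)$ for all complete $\mathcal{A}$ and tuples $\vec a$ of its constants. Tree witnesses: for $\varrho(x)$ of the form $S(x)$, $S(x,x)$, $\exists y\,S(x,y)$, $\exists y\,S(y,x)$ ($S$ in $\mathcal{T}$), $\mathcal{C}_\mathcal{T}^{\varrho(a)}$ is the canonical model of $(\mathcal{T}\cup\{A(x)\to\varrho(x)\},\{A(a)\})$, $A$ fresh. For a CQ $\exists\vec y\,\varphi(\vec x,\vec y)$ and disjoint variable sets $\mathfrak{t}_\mathsf{r},\mathfrak{t}_\mathsf{i}$ with $\emptyset\ne\mathfrak{t}_\mathsf{i}\subseteq\vec y$, ${\boldsymbol q}_\mathfrak{t}$ is the set of atoms $S(\vec z)$ with $\vec z\subseteq\mathfrak{t}_\mathsf{r}\cup\mathfrak{t}_\mathsf{i}$,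 $\vec z\not\subseteq\mathfrak{t}_\mathsf{r}$; $\mathfrak t=(\mathfrak{t}_\mathsf{r},\mathfrak{t}_\mathsf{i})$ is a tree witness generated by $\varrho$ if ${\boldsymbol q}_\mathfrak{t}$ is a minimal set of atoms for which there is a homomorphism $h\colon{\boldsymbol q}_\mathfrak{t}\to\mathcal{C}_\mathcal{T}^{\varrho(a)}$ with $\mathfrak{t}_\mathsf{r}=h^{-1}(a)$ and ${\boldsymbol q}_\mathfrak{t}$ contains all atoms with a variable in $\mathfrak{t}_\mathsf{i}$. Let $\mathsf{tw}_\mathfrak{t}(\mathfrak{t}_\mathsf{r})=\bigvee_{\mathfrak t\text{ generated by }\varrho}\exists z\,(\varrho(z)\land\bigwedge_{x\in\mathfrak{t}_\mathsf{r}}(x=z))$. Definition of ${\boldsymbol q}^\dagger$, recursively for ${\boldsymbol q}(\vec x)=\exists\vec y\,\varphi(\vec x,\vec y)$: take the finest partition of $\exists\vec y\,\varphi$ into a conjunction $\bigwedge_j\exists\vec y_j\,\varphi_j(\vec x,\vec y_j)$ such that every atom containing a variable $y\in\vec y_j$ belongs to $\varphi_j$. Set $(\exists\vec y\,\varphi)^\dagger=\bigwedge_j\psi_j$, where $\psi_j=\varphi_j(\vec x)$ if $\vec y_j$ is empty, and otherwise, for a chosen $z\in\vec y_j$, $\psi_j=\exists z\,\big(\exists[\vec y_j\setminus\{z\}]\,\varphi_j(\vec x,\vec y_j)\big)^\dagger\ \lor\ \bigvee_{\mathfrak t}\exists\vec y_{j,\mathfrak t}\,\big(\big(\exists[\vec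 y_j\setminus\vec y_{j,\mathfrak t}]\,\varphi_{j,\mathfrak t}(\vec x,\vec y_j)\big)^\dagger\land\mathsf{tw}_\mathfrak{t}(\mathfrak{t}_\mathsf{r})\big)$, the disjunction ranging over tree witnesses $\mathfrak t=(\mathfrak{t}_\mathsf{r},\mathfrak{t}_\mathsf{i})$ for $\exists\vec y_j\,\varphi_j$ and $\mathcal{T}$ with $z\in\mathfrak{t}_\mathsf{i}$; here $\vec y_{j,\mathfrak t}=\vec y_j\cap\mathfrak{t}_\mathsf{r}$, $\exists[\vec W]$ quantifies the listed variables, and $\varphi_{j,\mathfrak t}$ consists of the atoms of $\varphi_j$ not in ${\boldsymbol q}_\mathfrak{t}$ (in the inner recursive calls, the non-quantified variables are treated as answer variables).
   Formalization: Minimality of q_t in the definition of a tree witness is taken relative to a fixed homomorphism h (minimality over all homomorphisms makes the claim false); tgd bodies are read as single atoms, and the CQ is assumed to have at least one atom. *)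

theory Defs
  imports Main
begin

type_synonym var = nat
type_synonym const = nat

text \<open>
  The type of arguments is a parameter: with variables, constants or domain elements as arguments
  one obtains the atoms of formulas, ground atoms, and the facts that hold in a structure.
\<close>

datatype (atom_preds: 'p, args: 'a) atom = Unary 'p 'a | Binary 'p 'a 'a

abbreviation inst :: "('a \<Rightarrow> 'b) \<Rightarrow> ('p, 'a) atom \<Rightarrow> ('p, 'b) atom" where
  "inst s \<equiv> map_atom id s"

definition vars_of :: "('p, 'a) atom set \<Rightarrow> 'a set" where
  "vars_of \<phi> = (\<Union>\<alpha>\<in>\<phi>. args \<alpha>)"

datatype 'p pe =
    Atom "('p, var) atom"
  | Eq var var
  | Conj "'p pe list"
  | Disj "'p pe list"
  | Ex var "'p pe"

fun fv :: "'p pe \<Rightarrow> var set" where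
  "fv (Atom \<alpha>) = args \<alpha>"
| "fv (Eq x y) = {x, y}"
| "fv (Conj \<psi>s) = (\<Union>\<psi>\<in>set \<psi>s. fv \<psi>)"
| "fv (Disj \<psi>s) = (\<Union>\<psi>\<in>set \<psi>s. fv \<psi>)"
| "fv (Ex x \<psi>) = fv \<psi> - {x}"

fun sat :: "'d set \<Rightarrow> ('p, 'd) atom set \<Rightarrow> (var \<Rightarrow> 'd) \<Rightarrow> 'p pe \<Rightarrow> bool" where
  "sat D F s (Atom \<alpha>) \<longleftrightarrow> inst s \<alpha> \<in> F"
| "sat D F s (Eq x y) \<longleftrightarrow> s x = s y"
| "sat D F s (Conj \<psi>s) \<longleftrightarrow> (\<forall>\<psi>\<in>set \<psi>s. sat D F s \<psi>)"
| "sat D F s (Disj \<psi>s) \<longleftrightarrow> (\<exists>\<psi>\<in>set \<psi>s. sat D F s \<psi>)"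
| "sat D F s (Ex x \<psi>) \<longleftrightarrow> (\<exists>d\<in>D. sat D F (s(x := d)) \<psi>)"

definition list_of :: "'a set \<Rightarrow> 'a list" where
  "list_of S = (SOME xs. set xs = S \<and> distinct xs)"

lemma list_of: "finite S \<Longrightarrow> set (list_of S) = S \<and> distinct (list_of S)"
  unfolding list_of_def by (rule someI_ex) (rule finite_distinct_list)

definition Exs :: "var set \<Rightarrow> 'p pe \<Rightarrow> 'p pe" where
  "Exs Y \<psi> = foldr Ex (list_of Y) \<psi>"

text \<open>
  The variables of the body are universally quantified, the remaining variables of the head
  existentially; the head list is read as a conjunction.
\<close>

datatype 'p tgd = TGD (body: "('p, var) atom") (head: "('p, var) atom list")

definition ontology :: "'p tgd set \<Rightarrow> bool" where
  "ontology T \<longleftrightarrow> finite T \<and> (\<forall>t\<in>T. card (args (body t) \<union> vars_of (set (head t))) \<le> 2)"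

definition sat_tgd :: "'d set \<Rightarrow> ('p, 'd) atom set \<Rightarrow> 'p tgd \<Rightarrow> bool" where
  "sat_tgd D F t \<longleftrightarrow>
     (\<forall>s. range s \<subseteq> D \<longrightarrow> inst s (body t) \<in> F \<longrightarrow>
       (\<exists>s'. range s' \<subseteq> D \<and> (\<forall>x\<in>args (body t). s' x = s x) \<and>
             (\<forall>\<alpha>\<in>set (head t). inst s' \<alpha> \<in> F)))"

abbreviation ind :: "('p, const) atom set \<Rightarrow> const set" where
  "ind A \<equiv> vars_of A"

definition model_of ::
  "'p tgd set \<Rightarrow> ('p, const) atom set \<Rightarrow> 'd set \<Rightarrow> ('p, 'd) atom set \<Rightarrow> (const \<Rightarrow> 'd) \<Rightarrow> bool" where
  "model_of T A D F c \<longleftrightarrow>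
     D \<noteq> {} \<and> vars_of F \<subseteq> D \<and> range c \<subseteq> D \<and>
     (\<forall>t\<in>T. sat_tgd D F t) \<and> (\<forall>\<alpha>\<in>A. inst c \<alpha> \<in> F)"

text \<open>
  \<open>entails TYPE('d) T A s \<psi>\<close> says that \<open>T, A \<Turnstile> \<psi>(s)\<close>, where the constants \<open>s x\<close> are substituted for
  the free variables \<open>x\<close> of \<open>\<psi>\<close>. Models have arbitrary nonempty subsets of \<open>'d\<close> as domains; by
  the Loewenheim-Skolem theorem every infinite type \<open>'d\<close> yields the usual notion.
\<close>

definition entails ::
  "'d itself \<Rightarrow> 'p tgd set \<Rightarrow> ('p, const) atom set \<Rightarrow> (var \<Rightarrow> const) \<Rightarrow> 'p pe \<Rightarrow> bool" where
  "entails _ T A s \<psi> \<longleftrightarrow> (\<forall>(D :: 'd set) F c. model_of T A D F c \<longrightarrow> sat D F (c \<circ> s) \<psi>)"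

definition entails_ground ::
  "'d itself \<Rightarrow> 'p tgd set \<Rightarrow> ('p, const) atom set \<Rightarrow> ('p, const) atom \<Rightarrow> bool" where
  "entails_ground _ T A \<alpha> \<longleftrightarrow> (\<forall>(D :: 'd set) F c. model_of T A D F c \<longrightarrow> inst c \<alpha> \<in> F)"

definition complete_data :: "'d itself \<Rightarrow> 'p tgd set \<Rightarrow> ('p, const) atom set \<Rightarrow> bool" where
  "complete_data ty T A \<longleftrightarrow> finite A \<and> (\<forall>\<alpha>. args \<alpha> \<subseteq> ind A \<longrightarrow> entails_ground ty T A \<alpha> \<longrightarrow> \<alpha> \<in> A)"

text \<open>
  A tuple of constants for the answer variables \<open>X\<close> is an assignment \<open>s\<close> with \<open>s ` X \<subseteq> ind A\<close>.
  The rewriting is evaluated in the structure with domain \<open>ind A\<close> whose facts are those of \<open>A\<close>.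
\<close>

definition PE_rewriting_complete ::
  "'d itself \<Rightarrow> 'p tgd set \<Rightarrow> var set \<Rightarrow> 'p pe \<Rightarrow> 'p pe \<Rightarrow> bool" where
  "PE_rewriting_complete ty T X q q' \<longleftrightarrow>
     fv q' \<subseteq> X \<and>
     (\<forall>A s. complete_data ty T A \<longrightarrow> s ` X \<subseteq> ind A \<longrightarrow>
        (entails ty T A s q \<longleftrightarrow> sat (ind A) A s q'))"

definition is_cq :: "var set \<Rightarrow> var set \<Rightarrow> ('p, var) atom set \<Rightarrow> bool" where
  "is_cq X Y \<phi> \<longleftrightarrow>
     finite X \<and> finite Y \<and> X \<inter> Y = {} \<and> finite \<phi> \<and> \<phi> \<noteq> {} \<and> vars_of \<phi> \<subseteq> X \<union> Y"

definition cq :: "var set \<Rightarrow> ('p, var) atom set \<Rightarrow> 'p pe" where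
  "cq Y \<phi> = Exs Y (Conj (map Atom (list_of \<phi>)))"

text \<open>\<open>Null t y es\<close> is the null for the existential variable \<open>y\<close> of \<open>t\<close>, where \<open>es\<close> are the values of the
  body variables of \<open>t\<close> in increasing order.\<close>

datatype ('p, 'c) elem = Const 'c | Null "'p tgd" var "('p, 'c) elem list"

definition skolem :: "'p tgd \<Rightarrow> (var \<Rightarrow> ('p, 'c) elem) \<Rightarrow> var \<Rightarrow> ('p, 'c) elem" where
  "skolem t s v =
     (if v \<in> args (body t) then s v
      else Null t v (map s (sorted_list_of_set (args (body t)))))"

inductive_set canon :: "'p tgd set \<Rightarrow> ('p, 'c) atom set \<Rightarrow> ('p, ('p, 'c) elem) atom set"
  for T :: "'p tgd set" and A :: "('p, 'c) atom set" where
  data: "\<alpha> \<in> A \<Longrightarrow> inst Const \<alpha> \<in> canon T A"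
| chase: "t \<in> T \<Longrightarrow> inst s (body t) \<in> canon T A \<Longrightarrow> \<alpha> \<in> set (head t) \<Longrightarrow>
          inst (skolem t s) \<alpha> \<in> canon T A"

text \<open>The formulas \<open>S(x)\<close>, \<open>S(x,x)\<close>, \<open>\<exists>y S(x,y)\<close> and \<open>\<exists>y S(y,x)\<close>:\<close>

datatype 'p gen = GUn 'p | GLoop 'p | GOut 'p | GIn 'p

fun gen_atom :: "'p gen \<Rightarrow> var \<Rightarrow> var \<Rightarrow> ('p, var) atom" where
  "gen_atom (GUn S) x y = Unary S x"
| "gen_atom (GLoop S) x y = Binary S x x"
| "gen_atom (GOut S) x y = Binary S x y"
| "gen_atom (GIn S) x y = Binary S y x"

fun gen_pe :: "'p gen \<Rightarrow> var \<Rightarrow> 'p pe" where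
  "gen_pe (GUn S) x = Atom (Unary S x)"
| "gen_pe (GLoop S) x = Atom (Binary S x x)"
| "gen_pe (GOut S) x = Ex (Suc x) (Atom (Binary S x (Suc x)))"
| "gen_pe (GIn S) x = Ex (Suc x) (Atom (Binary S (Suc x) x))"

definition tgd_atoms :: "'p tgd set \<Rightarrow> ('p, var) atom set" where
  "tgd_atoms T = (\<Union>t\<in>T. insert (body t) (set (head t)))"

fun gen_in :: "'p tgd set \<Rightarrow> 'p gen \<Rightarrow> bool" where
  "gen_in T (GUn S) \<longleftrightarrow> (\<exists>x. Unary S x \<in> tgd_atoms T)"
| "gen_in T (GLoop S) \<longleftrightarrow> (\<exists>x y. Binary S x y \<in> tgd_atoms T)"
| "gen_in T (GOut S) \<longleftrightarrow> (\<exists>x y. Binary S x y \<in> tgd_atoms T)"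
| "gen_in T (GIn S) \<longleftrightarrow> (\<exists>x y. Binary S x y \<in> tgd_atoms T)"

text \<open>
  The predicates are extended to \<open>'p option\<close>, with \<open>None\<close> as the fresh unary predicate; the constant
  \<open>a\<close> is \<open>()\<close>.
\<close>

definition canon_gen :: "'p tgd set \<Rightarrow> 'p gen \<Rightarrow> ('p option, ('p option, unit) elem) atom set" where
  "canon_gen T \<rho> =
     canon (map_tgd Some ` T \<union> {TGD (Unary None 0) [map_atom Some id (gen_atom \<rho> 0 1)]}) {Unary None ()}"

type_synonym witness = "var set \<times> var set"

definition q_of :: "('p, var) atom set \<Rightarrow> witness \<Rightarrow> ('p, var) atom set" where
  "q_of \<phi> t = {\<alpha> \<in> \<phi>. args \<alpha> \<subseteq> fst t \<union> snd t \<and> \<not> args \<alpha> \<subseteq> fst t}"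

text \<open>
  Since \<open>h\<close> is a map on the variables of \<open>q_of \<phi> t\<close>, both components of \<open>t\<close> consist of such variables.
\<close>

definition tw_hom ::
  "'p tgd set \<Rightarrow> var set \<Rightarrow> ('p, var) atom set \<Rightarrow> 'p gen \<Rightarrow> witness \<Rightarrow>
   (var \<Rightarrow> ('p option, unit) elem) \<Rightarrow> bool" where
  "tw_hom T Y \<phi> \<rho> t h \<longleftrightarrow>
     fst t \<inter> snd t = {} \<and> snd t \<noteq> {} \<and> snd t \<subseteq> Y \<and>
     fst t \<union> snd t = vars_of (q_of \<phi> t) \<and>
     map_atom Some h ` q_of \<phi> t \<subseteq> canon_gen T \<rho> \<and>
     fst t = {x \<in> vars_of (q_of \<phi> t). h x = Const ()} \<and>
     (\<forall>\<alpha>\<in>\<phi>. args \<alpha> \<inter> snd t \<noteq> {} \<longrightarrow> \<alpha> \<in> q_of \<phi> t)"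

text \<open>
  Minimality is with respect to the given homomorphism. Comparing with all \<open>t'\<close> that have some
  homomorphism of their own would discard needed witnesses: for
  \<open>A(x) \<rightarrow> \<exists>y (S(x,y) \<and> B(y))\<close>, \<open>B(x) \<rightarrow> \<exists>y P(x,y)\<close>, \<open>A(x) \<rightarrow> \<exists>y P(x,y)\<close> and the query
  \<open>\<exists>z w (S(x,z) \<and> P(z,w))\<close>, the pair \<open>({z}, {w})\<close> would rule out \<open>({x}, {z, w})\<close>, which is the only
  one that covers the data \<open>{A(c)}\<close>.
\<close>

definition tree_witness_by ::
  "'p tgd set \<Rightarrow> var set \<Rightarrow> ('p, var) atom set \<Rightarrow> 'p gen \<Rightarrow> witness \<Rightarrow> bool" where
  "tree_witness_by T Y \<phi> \<rho> t \<longleftrightarrow>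
     gen_in T \<rho> \<and>
     (\<exists>h. tw_hom T Y \<phi> \<rho> t h \<and> \<not> (\<exists>t'. tw_hom T Y \<phi> \<rho> t' h \<and> q_of \<phi> t' \<subset> q_of \<phi> t))"

definition tree_witness :: "'p tgd set \<Rightarrow> var set \<Rightarrow> ('p, var) atom set \<Rightarrow> witness \<Rightarrow> bool" where
  "tree_witness T Y \<phi> t \<longleftrightarrow> (\<exists>\<rho>. tree_witness_by T Y \<phi> \<rho> t)"

definition tw :: "'p tgd set \<Rightarrow> var set \<Rightarrow> ('p, var) atom set \<Rightarrow> witness \<Rightarrow> 'p pe" where
  "tw T Y \<phi> t =
     (let z = (LEAST z. z \<notin> fst t) in
      Disj (map (\<lambda>\<rho>. Ex z (Conj (gen_pe \<rho> z # map (\<lambda>x. Eq x z) (list_of (fst t)))))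
                (list_of {\<rho>. tree_witness_by T Y \<phi> \<rho> t})))"

definition is_decomp ::
  "var set \<Rightarrow> ('p, var) atom set \<Rightarrow> (var set \<times> ('p, var) atom set) set \<Rightarrow> bool" where
  "is_decomp Y \<phi> P \<longleftrightarrow>
     \<Union>(fst ` P) = Y \<and> \<Union>(snd ` P) = \<phi> \<and> ({}, {}) \<notin> P \<and>
     (\<forall>p\<in>P. \<forall>p'\<in>P. p \<noteq> p' \<longrightarrow> fst p \<inter> fst p' = {} \<and> snd p \<inter> snd p' = {}) \<and>
     (\<forall>p\<in>P. \<forall>\<alpha>\<in>\<phi>. args \<alpha> \<inter> fst p \<noteq> {} \<longrightarrow> \<alpha> \<in> snd p)"

definition finest_decomp ::
  "var set \<Rightarrow> ('p, var) atom set \<Rightarrow> (var set \<times> ('p, var) atom set) set \<Rightarrow> bool" where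
  "finest_decomp Y \<phi> P \<longleftrightarrow>
     is_decomp Y \<phi> P \<and>
     (\<forall>P'. is_decomp Y \<phi> P' \<longrightarrow> (\<forall>p\<in>P. \<exists>p'\<in>P'. fst p \<subseteq> fst p' \<and> snd p \<subseteq> snd p'))"

text \<open>
  \<open>dagger T Y \<phi> \<psi>\<close>: for suitable choices of the variables \<open>z\<close>, \<open>\<psi>\<close> is the formula obtained from
  \<open>\<exists>Y \<phi>\<close>; \<open>dagger_part\<close> is the same for the conjuncts of the decomposition. The choice
  of \<open>z\<close> is free at every single step.
\<close>

inductive dagger :: "'p tgd set \<Rightarrow> var set \<Rightarrow> ('p, var) atom set \<Rightarrow> 'p pe \<Rightarrow> bool"
  and dagger_part :: "'p tgd set \<Rightarrow> var set \<Rightarrow> ('p, var) atom set \<Rightarrow> 'p pe \<Rightarrow> bool"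
  for T :: "'p tgd set" where
  dagger:
    "finest_decomp Y \<phi> P \<Longrightarrow>
     list_all2 (\<lambda>p \<psi>. dagger_part T (fst p) (snd p) \<psi>) (list_of P) \<psi>s \<Longrightarrow>
     dagger T Y \<phi> (Conj \<psi>s)"
| part_ground:
    "dagger_part T {} \<phi> (Conj (map Atom (list_of \<phi>)))"
| part_ex:
    "z \<in> Y \<Longrightarrow>
     dagger T (Y - {z}) \<phi> \<psi> \<Longrightarrow>
     ts = list_of {t. tree_witness T Y \<phi> t \<and> z \<in> snd t} \<Longrightarrow>
     list_all2 (\<lambda>t \<chi>. dagger T (Y - Y \<inter> fst t) (\<phi> - q_of \<phi> t) \<chi>) ts \<chi>s \<Longrightarrow>
     dagger_part T Y \<phi>
       (Disj (Ex z \<psi> # map2 (\<lambda>t \<chi>. Exs (Y \<inter> fst t) (Conj [\<chi>, tw T Y \<phi> t])) ts \<chi>s))"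

text \<open>The recursion always terminates, i.e. every CQ has at least one \<open>dagger\<close>-formula.\<close>

lemma finite_args: "finite (args (\<alpha> :: ('p, 'a) atom))"
  by (cases \<alpha>) auto

lemma ex_finest_decomp:
  fixes \<phi> :: "('p, var) atom set"
  shows "\<exists>P. finest_decomp Y \<phi> P"
proof -
  define E :: "((var + ('p, var) atom) \<times> (var + ('p, var) atom)) set" where "E = {(Inl y, Inr \<alpha>) | y \<alpha>. y \<in> Y \<and> \<alpha> \<in> \<phi> \<and> y \<in> args \<alpha>}"
  define R where "R = (E \<union> E\<inverse>)\<^sup>*"
  define part where "part u = ({y \<in> Y. (u, Inl y) \<in> R}, {\<alpha> \<in> \<phi>. (u, Inr \<alpha>) \<in> R})" for u
  define P where "P = part ` (Y <+> \<phi>)"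
  have sym: "(v, u) \<in> R" if "(u, v) \<in> R" for u v
    using that unfolding R_def by (metis sym_Un_converse sym_rtrancl symD)
  have trans: "(u, w) \<in> R" if "(u, v) \<in> R" "(v, w) \<in> R" for u v w
    using that unfolding R_def by (rule rtrancl_trans)
  have refl: "(u, u) \<in> R" for u
    unfolding R_def by simp
  have edge: "(Inl y, Inr \<alpha>) \<in> R" if "y \<in> Y" "\<alpha> \<in> \<phi>" "y \<in> args \<alpha>" for y \<alpha>
    using that unfolding R_def E_def by auto
  have same: "part u = part v" if "(u, v) \<in> R" for u v
    using that sym trans unfolding part_def by blast
  have fst_iff: "y \<in> fst (part u) \<longleftrightarrow> y \<in> Y \<and> (u, Inl y) \<in> R" for y u
    by (simp add: part_def)
  have snd_iff: "\<alpha> \<in> snd (part u) \<longleftrightarrow> \<alpha> \<in> \<phi> \<and> (u, Inr \<alpha>) \<in> R" for \<alpha> u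
    by (simp add: part_def)
  have dec: "is_decomp Y \<phi> P"
    unfolding is_decomp_def
  proof (intro conjI)
    show "\<Union>(fst ` P) = Y"
      unfolding P_def using fst_iff refl by (auto 4 4)
    show "\<Union>(snd ` P) = \<phi>"
      unfolding P_def using snd_iff refl by (auto 4 4)
    show "({}, {}) \<notin> P"
    proof
      assume "({}, {}) \<in> P"
      then obtain u where u: "u \<in> Y <+> \<phi>" "part u = ({}, {})"
        unfolding P_def by (metis imageE)
      show False
      proof (cases u)
        case (Inl y)
        then have "y \<in> fst (part u)" using u(1) refl by (auto simp: fst_iff)
        then show False using u(2) by simp
      next
        case (Inr \<alpha>)
        then have "\<alpha> \<in> snd (part u)" using u(1) refl by (auto simp: snd_iff)
        then show False using u(2) by simp
      qed
    qed
    show "\<forall>p\<in>P. \<forall>p'\<in>P. p \<noteq> p' \<longrightarrow> fst p \<inter> fst p' = {} \<and> snd p \<inter> snd p' = {}"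
    proof (intro ballI impI)
      fix p p' assume "p \<in> P" "p' \<in> P" and ne: "p \<noteq> p'"
      then obtain u v where uv: "p = part u" "p' = part v" unfolding P_def by auto
      have nr: "(u, w) \<notin> R \<or> (v, w) \<notin> R" for w
        using ne uv same sym trans by blast
      show "fst p \<inter> fst p' = {} \<and> snd p \<inter> snd p' = {}"
        using nr by (auto simp: uv fst_iff snd_iff)
    qed
    show "\<forall>p\<in>P. \<forall>\<alpha>\<in>\<phi>. args \<alpha> \<inter> fst p \<noteq> {} \<longrightarrow> \<alpha> \<in> snd p"
    proof (intro ballI impI)
      fix p \<alpha> assume "p \<in> P" and \<alpha>: "\<alpha> \<in> \<phi>" "args \<alpha> \<inter> fst p \<noteq> {}"
      then obtain u where u: "p = part u" unfolding P_def by auto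
      from \<alpha> obtain y where "y \<in> args \<alpha>" "y \<in> Y" "(u, Inl y) \<in> R" by (auto simp: u fst_iff)
      then have "(u, Inr \<alpha>) \<in> R" using edge \<alpha>(1) trans by blast
      then show "\<alpha> \<in> snd p" using \<alpha>(1) by (simp add: u snd_iff)
    qed
  qed
  have fine: "\<exists>p'\<in>P'. fst p \<subseteq> fst p' \<and> snd p \<subseteq> snd p'" if P': "is_decomp Y \<phi> P'" and p: "p \<in> P" for P' p
  proof -
    have cov: "\<Union>(fst ` P') = Y" "\<Union>(snd ` P') = \<phi>"
      and disj: "\<And>p p'. p \<in> P' \<Longrightarrow> p' \<in> P' \<Longrightarrow> p \<noteq> p' \<Longrightarrow> fst p \<inter> fst p' = {} \<and> snd p \<inter> snd p' = {}"
      and clo: "\<And>p \<alpha>. p \<in> P' \<Longrightarrow> \<alpha> \<in> \<phi> \<Longrightarrow> args \<alpha> \<inter> fst p \<noteq> {} \<Longrightarrow> \<alpha> \<in> snd p"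
      using P' unfolding is_decomp_def by (blast, blast, meson, meson)
    obtain u where u: "u \<in> Y <+> \<phi>" "p = part u" using p unfolding P_def by auto
    obtain p' where p': "p' \<in> P'" and up: "u \<in> fst p' <+> snd p'"
      using u(1) cov by (cases u) (auto 4 4)
    have step: "w \<in> fst p' <+> snd p'"
      if "v \<in> fst p' <+> snd p'" "(v, w) \<in> E \<union> E\<inverse>" for v w
    proof -
      from that(2) obtain y \<alpha> where e: "y \<in> Y" "\<alpha> \<in> \<phi>" "y \<in> args \<alpha>"
        and c: "(v = Inl y \<and> w = Inr \<alpha>) \<or> (v = Inr \<alpha> \<and> w = Inl y)"
        unfolding E_def by auto
      from c show ?thesis
      proof
        assume "v = Inl y \<and> w = Inr \<alpha>"
        then show ?thesis using that(1) e clo[OF p'] by auto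
      next
        assume vw: "v = Inr \<alpha> \<and> w = Inl y"
        obtain p'' where p'': "p'' \<in> P'" "y \<in> fst p''" using e(1) cov(1) by auto
        then have "\<alpha> \<in> snd p''" using clo e by blast
        moreover have "\<alpha> \<in> snd p'" using that(1) vw by auto
        ultimately have "p'' = p'" using disj p' p''(1) by blast
        then show ?thesis using vw p'' by auto
      qed
    qed
    have reach: "w \<in> fst p' <+> snd p'" if "(u, w) \<in> R" for w
      using that unfolding R_def
      by (induction rule: rtrancl_induct) (auto intro: up step)
    show ?thesis
      using p' reach unfolding u(2) part_def by (intro bexI[of _ p']) auto
  qed
  show ?thesis
    using dec fine unfolding finest_decomp_def by blast
qed

lemma ex_dagger:
  fixes T :: "'p tgd set" and \<phi> :: "('p, var) atom set"
  assumes "finite Y" "finite \<phi>"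
  shows "\<exists>\<psi>. dagger T Y \<phi> \<psi>"
  using assms
proof (induction "card Y + card \<phi>" arbitrary: Y \<phi> rule: less_induct)
  case less
  obtain P where P: "finest_decomp Y \<phi> P" using ex_finest_decomp by blast
  have cov: "\<Union>(fst ` P) = Y" "\<Union>(snd ` P) = \<phi>"
    using P unfolding finest_decomp_def is_decomp_def by auto
  have "P \<subseteq> Pow Y \<times> Pow \<phi>" using cov by force
  then have finP: "finite P" using less.prems by (meson finite_Pow_iff finite_SigmaI finite_subset)
  have "\<exists>\<psi>. dagger_part T (fst p) (snd p) \<psi>" if p: "p \<in> P" for p
  proof -
    obtain V \<theta> where [simp]: "p = (V, \<theta>)" by (cases p)
    have sub: "V \<subseteq> Y" "\<theta> \<subseteq> \<phi>" using cov p by force+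
    have fin: "finite V" "finite \<theta>" using sub less.prems finite_subset by blast+
    have le: "card V \<le> card Y" "card \<theta> \<le> card \<phi>" using sub less.prems card_mono by blast+
    show ?thesis
    proof (cases "V = {}")
      case True
      then show ?thesis using part_ground by (metis \<open>p = (V, \<theta>)\<close> fst_conv snd_conv)
    next
      case False
      then obtain z where z: "z \<in> V" by blast
      have "card (V - {z}) < card V" using z fin(1) by (rule card_Diff1_less[rotated])
      then have "card (V - {z}) + card \<theta> < card Y + card \<phi>" using le by linarith
      then obtain \<psi> where \<psi>: "dagger T (V - {z}) \<theta> \<psi>"
        using less.hyps fin by blast
      define W where "W = {t. tree_witness T V \<theta> t \<and> z \<in> snd t}"
      have tw_props: "fst t \<union> snd t = vars_of (q_of \<theta> t)" "snd t \<noteq> {}" if "t \<in> W" for t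
        using that unfolding W_def tree_witness_def tree_witness_by_def tw_hom_def by auto
      have "W \<subseteq> Pow (vars_of \<theta>) \<times> Pow (vars_of \<theta>)"
      proof
        fix t assume "t \<in> W"
        then have "fst t \<union> snd t \<subseteq> vars_of \<theta>"
          using tw_props(1)[of t] unfolding q_of_def vars_of_def by auto
        then show "t \<in> Pow (vars_of \<theta>) \<times> Pow (vars_of \<theta>)" by (cases t) auto
      qed
      moreover have "finite (vars_of \<theta>)" using fin finite_args unfolding vars_of_def by blast
      ultimately have finW: "finite W"
        by (meson finite_Pow_iff finite_SigmaI finite_subset)
      have "\<exists>\<chi>. dagger T (V - V \<inter> fst t) (\<theta> - q_of \<theta> t) \<chi>" if "t \<in> W" for t
      proof -
        have "q_of \<theta> t \<noteq> {}" using tw_props[OF that] by (auto simp: vars_of_def)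
        moreover have "q_of \<theta> t \<subseteq> \<theta>" by (auto simp: q_of_def)
        ultimately have "\<theta> - q_of \<theta> t \<subset> \<theta>" by blast
        then have "card (\<theta> - q_of \<theta> t) < card \<theta>" using fin psubset_card_mono by blast
        moreover have "card (V - V \<inter> fst t) \<le> card V" using fin by (simp add: card_mono)
        ultimately have "card (V - V \<inter> fst t) + card (\<theta> - q_of \<theta> t) < card Y + card \<phi>"
          using le by linarith
        then show ?thesis using less.hyps fin by blast
      qed
      then obtain f where f: "\<And>t. t \<in> W \<Longrightarrow> dagger T (V - V \<inter> fst t) (\<theta> - q_of \<theta> t) (f t)"
        by metis
      have "list_all2 (\<lambda>t \<chi>. dagger T (V - V \<inter> fst t) (\<theta> - q_of \<theta> t) \<chi>) (list_of W) (map f (list_of W))"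
        using f list_of[OF finW] by (simp add: list_all2_conv_all_nth) (metis nth_mem)
      then show ?thesis
        using part_ex[OF z \<psi>] unfolding W_def by fastforce
    qed
  qed
  then obtain g where g: "\<And>p. p \<in> P \<Longrightarrow> dagger_part T (fst p) (snd p) (g p)" by metis
  have "list_all2 (\<lambda>p \<psi>. dagger_part T (fst p) (snd p) \<psi>) (list_of P) (map g (list_of P))"
    using g list_of[OF finP] by (simp add: list_all2_conv_all_nth) (metis nth_mem)
  then show ?case using dagger_dagger_part.dagger[OF P] by blast
qed

end

theory Submission
  imports Defs "HOL-Library.Countable_Set"
begin

text \<open>
  The query is entailed iff it has a homomorphism \<open>h\<close> into the canonical model, and over complete data
  the atoms of the canonical model without nulls are exactly those of the data. Fix the chosen variable
  \<open>z\<close>. If \<open>h z\<close> is a constant, the first disjunct applies. Otherwise \<open>h z\<close> lies on a branch of nulls below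
  some constant \<open>a\<close>; since tgd bodies are single atoms and at most two variables occur in a tgd, the
  whole branch is generated by one atom over \<open>a\<close>, so it embeds into the canonical model of the
  corresponding generator. The variables reachable from \<open>z\<close> through variables sent to nulls stay on
  this branch, can be left only through \<open>a\<close>, and thus form a tree witness. Conversely, the canonical
  model of a generator that holds at \<open>a\<close> maps into the canonical model of the data.
\<close>

section \<open>Universality of the canonical model\<close>

lemma map_atom_comp: "map_atom f g (map_atom f' g' \<alpha>) = map_atom (f \<circ> f') (g \<circ> g') \<alpha>"
  by (simp add: atom.map_comp)

lemma map_atom_ident: "map_atom (\<lambda>p. p) = map_atom id"
  by (simp add: id_def)

lemma map_atom_cong_args: "(\<And>x. x \<in> args \<alpha> \<Longrightarrow> g x = g' x) \<Longrightarrow> map_atom f g \<alpha> = map_atom f g' \<alpha>"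
  by (rule atom.map_cong) auto

lemma args_map_atom: "args (map_atom f g \<alpha>) = g ` args \<alpha>"
  by (rule atom.set_map)

definition body_vars :: "'p tgd \<Rightarrow> var list" where
  "body_vars t = sorted_list_of_set (args (body t))"

lemma set_body_vars: "set (body_vars t) = args (body t)"
  by (simp add: body_vars_def finite_args)

text \<open>Witnesses for the head of \<open>t\<close> are indexed by the list \<open>ds\<close> of
  body values rather than by an assignment. A \<open>Null\<close> stores just such a list, so the
  null alone determines which witness to use.\<close>

definition heads_hold ::
  "'d set \<Rightarrow> ('p, 'd) atom set \<Rightarrow> 'p tgd \<Rightarrow> 'd list \<Rightarrow> (var \<Rightarrow> 'd) \<Rightarrow> bool" where
  "heads_hold D F t ds s \<longleftrightarrow>
     range s \<subseteq> D \<and> map s (body_vars t) = ds \<and> (\<forall>\<alpha>\<in>set (head t). inst s \<alpha> \<in> F)"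

text \<open>The range condition stands outside the implication because the type of elements also
  contains nulls that no chase step creates; these too must be sent into \<open>D\<close>.\<close>

definition tgd_choice :: "'d set \<Rightarrow> ('p, 'd) atom set \<Rightarrow> 'p tgd \<Rightarrow> 'd list \<Rightarrow> var \<Rightarrow> 'd" where
  "tgd_choice D F t ds =
     (SOME s. range s \<subseteq> D \<and> ((\<exists>s'. heads_hold D F t ds s') \<longrightarrow> heads_hold D F t ds s))"

lemma tgd_choice:
  assumes "D \<noteq> {}"
  shows "range (tgd_choice D F t ds) \<subseteq> D"
    and "heads_hold D F t ds s \<Longrightarrow> heads_hold D F t ds (tgd_choice D F t ds)"
proof -
  obtain d where "d \<in> D" using assms by blast
  then have "range (\<lambda>_ :: var. d) \<subseteq> D" by auto
  then have "\<exists>s. range s \<subseteq> D \<and> ((\<exists>s'. heads_hold D F t ds s') \<longrightarrow> heads_hold D F t ds s)"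
    by (metis heads_hold_def)
  from someI_ex[OF this] show "range (tgd_choice D F t ds) \<subseteq> D"
    and "heads_hold D F t ds s \<Longrightarrow> heads_hold D F t ds (tgd_choice D F t ds)"
    unfolding tgd_choice_def by blast+
qed

text \<open>Recursion on terms, not on derivations of atoms, gives a null one and the same image in
  all atoms in which it occurs.\<close>

primrec canon_hom :: "'d set \<Rightarrow> ('p, 'd) atom set \<Rightarrow> ('c \<Rightarrow> 'd) \<Rightarrow> ('p, 'c) elem \<Rightarrow> 'd" where
  "canon_hom D F c (Const a) = c a"
| "canon_hom D F c (Null t y es) = tgd_choice D F t (map (canon_hom D F c) es) y"

lemma canon_hom_in_domain:
  assumes "D \<noteq> {}" "range c \<subseteq> D"
  shows "canon_hom D F c e \<in> D"
proof (cases e)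
  case (Const a)
  then show ?thesis using assms(2) by auto
next
  case (Null t y es)
  then show ?thesis using subsetD[OF tgd_choice(1)[OF assms(1)] rangeI] by simp
qed

text \<open>Induction along the chase. The image of the body holds in the model, so some extension
  of it satisfies the head; hence the chosen assignment does so as well, and it coincides with the
  map composed with \<open>skolem t s\<close>.\<close>

lemma canon_hom:
  assumes D: "D \<noteq> {}" "range c \<subseteq> D"
    and T: "\<And>t. t \<in> T \<Longrightarrow> sat_tgd D F t"
    and A: "\<And>\<alpha>. \<alpha> \<in> A \<Longrightarrow> inst c \<alpha> \<in> F"
    and "\<beta> \<in> canon T A"
  shows "inst (canon_hom D F c) \<beta> \<in> F"
  using assms(5)
proof induction
  case (data \<alpha>)
  have "canon_hom D F c \<circ> Const = c" by auto
  then show ?case using A[OF data] by (simp add: map_atom_comp map_atom_ident)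
next
  case (chase t s \<alpha>)
  let ?g = "canon_hom D F c"
  let ?ds = "map (?g \<circ> s) (body_vars t)"
  have "range (?g \<circ> s) \<subseteq> D" using canon_hom_in_domain[OF D] by auto
  moreover have "inst (?g \<circ> s) (body t) \<in> F" using chase.IH by (simp add: map_atom_comp map_atom_ident)
  ultimately obtain s' where s': "range s' \<subseteq> D" "\<forall>x\<in>args (body t). s' x = (?g \<circ> s) x"
    "\<forall>\<alpha>\<in>set (head t). inst s' \<alpha> \<in> F"
    using T[OF chase.hyps(1)] unfolding sat_tgd_def by blast
  then have "heads_hold D F t ?ds s'"
    unfolding heads_hold_def by (simp add: set_body_vars)
  then have w: "heads_hold D F t ?ds (tgd_choice D F t ?ds)" by (rule tgd_choice(2)[OF D(1)])
  \<comment> \<open>On body variables the choice has to reproduce \<open>?ds\<close>; on the others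
    this is the recursion equation for \<open>Null\<close>.\<close>
  have "(?g \<circ> skolem t s) v = tgd_choice D F t ?ds v" for v
  proof (cases "v \<in> args (body t)")
    case True
    then have "tgd_choice D F t ?ds v = ?g (s v)"
      using w by (simp add: heads_hold_def set_body_vars)
    with True show ?thesis by (simp add: skolem_def)
  next
    case False
    then show ?thesis by (simp add: skolem_def body_vars_def)
  qed
  then have "?g \<circ> skolem t s = tgd_choice D F t ?ds" by blast
  then show ?case using w chase.hyps(3) by (simp add: heads_hold_def map_atom_comp map_atom_ident)
qed

lemma canon_constants: "\<beta> \<in> canon T A \<Longrightarrow> Const a \<in> args \<beta> \<Longrightarrow> a \<in> vars_of A"
proof (induction rule: canon.induct)
  case (data \<alpha>)
  then show ?case by (auto simp: args_map_atom vars_of_def)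
next
  case (chase t s \<alpha>)
  then show ?case by (auto simp: args_map_atom skolem_def split: if_splits)
qed

text \<open>The map into a model extends the interpretation of the constants, so an atom without
  nulls holds in every model and is entailed. By \<open>canon_constants\<close> it is over the
  constants of \<open>A\<close>, which is what completeness asks for.\<close>

lemma complete_data_canon:
  assumes "complete_data TYPE('d) T A" and "inst Const \<alpha> \<in> canon T A"
  shows "\<alpha> \<in> A"
proof -
  have "entails_ground TYPE('d) T A \<alpha>"
    unfolding entails_ground_def
  proof (intro allI impI)
    fix D :: "'d set" and F c assume m: "model_of T A D F c"
    have "inst (canon_hom D F c) (inst Const \<alpha>) \<in> F"
      using m by (intro canon_hom[OF _ _ _ _ assms(2)]) (auto simp: model_of_def)
    moreover have "canon_hom D F c \<circ> Const = c" by auto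
    ultimately show "inst c \<alpha> \<in> F" by (simp add: map_atom_comp)
  qed
  moreover have "args \<alpha> \<subseteq> ind A"
    using canon_constants[OF assms(2)] by (auto simp: args_map_atom)
  ultimately show ?thesis using assms(1) unfolding complete_data_def by blast
qed

section \<open>Entailment and homomorphisms into the canonical model\<close>

text \<open>All variables outside \<open>Y\<close> are pinned to constants. Instantiating a
  quantified \<open>z\<close> by \<open>d\<close> thus amounts to removing \<open>z\<close> from
  \<open>Y\<close> and passing to \<open>s(z := d)\<close>, as the recursive steps of the rewriting
  do.\<close>

definition cq_hom ::
  "'p tgd set \<Rightarrow> ('p, const) atom set \<Rightarrow> var set \<Rightarrow> ('p, var) atom set \<Rightarrow> (var \<Rightarrow> const) \<Rightarrow>
   (var \<Rightarrow> ('p, const) elem) \<Rightarrow> bool" where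
  "cq_hom T A Y \<phi> s h \<longleftrightarrow> (\<forall>x. x \<notin> Y \<longrightarrow> h x = Const (s x)) \<and> (\<forall>\<alpha>\<in>\<phi>. inst h \<alpha> \<in> canon T A)"

section \<open>Semantics of quantifier blocks and of conjunctive queries\<close>

lemma sat_foldr_Ex:
  "sat D F s (foldr Ex xs \<psi>) \<longleftrightarrow>
     (\<exists>s'. (\<forall>x. x \<notin> set xs \<longrightarrow> s' x = s x) \<and> s' ` set xs \<subseteq> D \<and> sat D F s' \<psi>)"
proof (induction xs arbitrary: s)
  case Nil
  have "s' = s" if "\<forall>x. s' x = s x" for s' using that by blast
  then show ?case by auto
next
  case (Cons y xs)
  show ?case
  proof
    assume "sat D F s (foldr Ex (y # xs) \<psi>)"
    then obtain d s' where d: "d \<in> D" and s': "\<forall>x. x \<notin> set xs \<longrightarrow> s' x = (s(y := d)) x"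
      "s' ` set xs \<subseteq> D" "sat D F s' \<psi>"
      using Cons.IH by auto
    \<comment> \<open>If \<open>y\<close> recurs in \<open>xs\<close>, an inner quantifier supplies
      its value; otherwise the value is \<open>d\<close>.\<close>
    have "s' y \<in> D" using s' d by (cases "y \<in> set xs") auto
    then show "\<exists>s'. (\<forall>x. x \<notin> set (y # xs) \<longrightarrow> s' x = s x) \<and> s' ` set (y # xs) \<subseteq> D \<and> sat D F s' \<psi>"
      using s' by (intro exI[of _ s']) auto
  next
    assume "\<exists>s'. (\<forall>x. x \<notin> set (y # xs) \<longrightarrow> s' x = s x) \<and> s' ` set (y # xs) \<subseteq> D \<and> sat D F s' \<psi>"
    then obtain s' where s': "\<forall>x. x \<notin> set (y # xs) \<longrightarrow> s' x = s x" "s' ` set (y # xs) \<subseteq> D"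
      "sat D F s' \<psi>" by blast
    then have "sat D F (s(y := s' y)) (foldr Ex xs \<psi>)"
      unfolding Cons.IH by (intro exI[of _ s']) auto
    then show "sat D F s (foldr Ex (y # xs) \<psi>)" using s'(2) by auto
  qed
qed

lemma sat_Exs:
  "finite Y \<Longrightarrow> sat D F s (Exs Y \<psi>) \<longleftrightarrow>
     (\<exists>s'. (\<forall>x. x \<notin> Y \<longrightarrow> s' x = s x) \<and> s' ` Y \<subseteq> D \<and> sat D F s' \<psi>)"
  by (simp add: Exs_def sat_foldr_Ex list_of)

lemma sat_cq:
  assumes "finite Y" "finite \<phi>"
  shows "sat D F s (cq Y \<phi>) \<longleftrightarrow>
     (\<exists>s'. (\<forall>x. x \<notin> Y \<longrightarrow> s' x = s x) \<and> s' ` Y \<subseteq> D \<and> (\<forall>\<alpha>\<in>\<phi>. inst s' \<alpha> \<in> F))"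
  using assms by (simp add: cq_def sat_Exs list_of)

text \<open>The composition of \<open>h\<close> with the map from the canonical model into a given
  model satisfies the query there.\<close>

lemma cq_hom_entails:
  fixes T :: "'p tgd set"
  assumes "finite Y" "finite \<phi>" and h: "cq_hom T A Y \<phi> s h"
  shows "entails TYPE('d) T A s (cq Y \<phi>)"
  unfolding entails_def
proof (intro allI impI)
  fix D :: "'d set" and F c assume m: "model_of T A D F c"
  let ?g = "canon_hom D F c"
  have D: "D \<noteq> {}" "range c \<subseteq> D" using m by (auto simp: model_of_def)
  have "inst ?g \<beta> \<in> F" if "\<beta> \<in> canon T A" for \<beta>
    using m by (intro canon_hom[OF D _ _ that]) (auto simp: model_of_def)
  then have "\<forall>\<alpha>\<in>\<phi>. inst (?g \<circ> h) \<alpha> \<in> F"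
    using h by (fastforce simp: cq_hom_def map_atom_comp)
  moreover have "\<forall>x. x \<notin> Y \<longrightarrow> (?g \<circ> h) x = (c \<circ> s) x" using h by (auto simp: cq_hom_def)
  moreover have "(?g \<circ> h) ` Y \<subseteq> D" using canon_hom_in_domain[OF D] by auto
  ultimately show "sat D F (c \<circ> s) (cq Y \<phi>)" using assms(1,2) by (auto simp only: sat_cq)
qed

text \<open>The type \<open>('p, 'c) elem\<close> may be uncountable, because \<open>'p\<close> is arbitrary; only the terms
  over the finite ontology are needed.\<close>

inductive_set herbrand :: "'p tgd set \<Rightarrow> ('p, 'c) elem set" for T where
  Const: "Const a \<in> herbrand T"
| Null: "t \<in> T \<Longrightarrow> es \<in> lists (herbrand T) \<Longrightarrow> Null t y es \<in> herbrand T"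

text \<open>The terms are built in stages: stage \<open>n\<close> is the \<open>n\<close>-fold
  iterate of \<open>step\<close> on the empty set, and it is countable since variables, tgds,
  constants and finite lists over a countable set are.\<close>

lemma countable_herbrand:
  assumes "countable T"
  shows "countable (herbrand T :: ('p, 'c :: countable) elem set)"
proof -
  define step :: "('p, 'c) elem set \<Rightarrow> ('p, 'c) elem set" where
    "step S = range Const \<union> (\<lambda>(t, y, es). Null t y es) ` (T \<times> UNIV \<times> lists S)" for S
  have mono: "S \<subseteq> S' \<Longrightarrow> step S \<subseteq> step S'" for S S'
    unfolding step_def by (intro Un_mono image_mono Sigma_mono lists_mono order_refl)
  have count: "countable ((step ^^ n) {})" for n
    by (induction n) (auto simp: step_def assms intro!: countable_SIGMA countable_image)
  have incr: "(step ^^ n) {} \<subseteq> (step ^^ Suc n) {}" for n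
    by (induction n) (auto dest: mono)
  have le: "(step ^^ m) {} \<subseteq> (step ^^ n) {}" if "m \<le> n" for m n
    using that by (rule lift_Suc_mono_le[where f = "\<lambda>n. (step ^^ n) {}", OF incr])
  have "\<exists>n. e \<in> (step ^^ n) {}" if "e \<in> herbrand T" for e
    using that
  proof induction
    case (Const a)
    have "Const a \<in> (step ^^ Suc 0) {}" by (simp add: step_def)
    then show ?case by blast
  next
    case (Null t es y)
    \<comment> \<open>The argument list is finite and the stages increase, so one stage contains all
      its members.\<close>
    have "\<exists>n. es \<in> lists ((step ^^ n) {})" using Null(2)
    proof (induction es)
      case (Cons e es)
      then obtain m n where "e \<in> (step ^^ m) {}" "es \<in> lists ((step ^^ n) {})" by auto
      then have "e \<in> (step ^^ max m n) {}" "es \<in> lists ((step ^^ max m n) {})"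
        using le[of m "max m n"] lists_mono[OF le[of n "max m n"]]
        by (meson max.cobounded1 max.cobounded2 subsetD)+
      then have "e # es \<in> lists ((step ^^ max m n) {})" by (rule lists.Cons)
      then show ?case by (rule exI)
    qed auto
    then obtain n where "es \<in> lists ((step ^^ n) {})" by blast
    then have "Null t y es \<in> (step ^^ Suc n) {}"
      unfolding funpow.simps comp_apply step_def using Null(1)
      by (intro UnI2 image_eqI[of _ _ "(t, y, es)"]) auto
    then show ?case by blast
  qed
  then have "herbrand T \<subseteq> (\<Union>n. (step ^^ n) {})" by blast
  moreover have "countable (\<Union>n. (step ^^ n) {})" by (rule countable_UN[OF countableI_type count])
  ultimately show ?thesis by (rule countable_subset)
qed

lemma skolem_herbrand:
  "t \<in> T \<Longrightarrow> s ` args (body t) \<subseteq> herbrand T \<Longrightarrow> skolem t s v \<in> herbrand T"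
  by (auto simp: skolem_def finite_args intro!: herbrand.Null)

lemma canon_herbrand: "\<beta> \<in> canon T A \<Longrightarrow> args \<beta> \<subseteq> herbrand T"
proof (induction rule: canon.induct)
  case (data \<alpha>)
  then show ?case by (auto simp: args_map_atom intro: herbrand.Const)
next
  case (chase t s \<alpha>)
  then show ?case using skolem_herbrand[OF chase.hyps(1)] by (auto simp: args_map_atom)
qed

text \<open>Entailment speaks only of models inside \<open>'d\<close>, so it is applied to a copy of
  the canonical model: the countable set of Herbrand terms embeds into the infinite type by
  \<open>e\<close>. A satisfying assignment in the copy is decoded by the inverse
  \<open>i\<close>.\<close>

lemma entails_cq_hom:
  fixes T :: "'p tgd set"
  assumes inf: "infinite (UNIV :: 'd set)" and fin: "finite T" "finite Y" "finite \<phi>"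
    and ent: "entails TYPE('d) T A s (cq Y \<phi>)"
  shows "\<exists>h. cq_hom T A Y \<phi> s h"
proof -
  let ?H = "herbrand T :: ('p, const) elem set"
  obtain f :: "nat \<Rightarrow> 'd" where f: "inj f"
    using infinite_countable_subset[OF inf] by blast
  have "countable ?H" using countable_herbrand countable_finite[OF fin(1)] by blast
  define e where "e = f \<circ> to_nat_on ?H"
  have inj: "inj_on e ?H"
    unfolding e_def using \<open>countable ?H\<close> f by (meson comp_inj_on inj_on_subset inj_on_to_nat_on subset_UNIV)
  define i where "i = inv_into ?H e"
  have ie: "i (e u) = u" if "u \<in> ?H" for u
    using that inj by (simp add: i_def)
  have i_in: "i d \<in> ?H" "e (i d) = d" if "d \<in> e ` ?H" for d
    using that by (auto simp: i_def inv_into_into f_inv_into_f)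
  let ?F = "inst e ` canon T A"
  \<comment> \<open>Facts of the copy decode to atoms of the canonical model, because
    \<open>e\<close> is injective on the terms that occur in them.\<close>
  have pull: "inst (i \<circ> s) \<alpha> \<in> canon T A" if "inst s \<alpha> \<in> ?F" for s and \<alpha> :: "('p, var) atom"
  proof -
    from that obtain \<beta> where \<beta>: "\<beta> \<in> canon T A" "inst s \<alpha> = inst e \<beta>" by blast
    have "inst (i \<circ> s) \<alpha> = inst i (inst s \<alpha>)" by (simp add: map_atom_comp)
    also have "\<dots> = inst (i \<circ> e) \<beta>" by (simp add: \<beta>(2) map_atom_comp)
    also have "\<dots> = inst id \<beta>"
      using canon_herbrand[OF \<beta>(1)] ie by (intro map_atom_cong_args) auto
    finally show ?thesis using \<beta>(1) by (simp add: atom.map_id)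
  qed
  have "model_of T A (e ` ?H) ?F (e \<circ> Const)"
    unfolding model_of_def
  proof (intro conjI ballI)
    show "e ` ?H \<noteq> {}" using herbrand.Const[of "0 :: const" T] by blast
    show "vars_of ?F \<subseteq> e ` ?H"
      using canon_herbrand[of _ T A] by (auto simp: vars_of_def args_map_atom)
    show "range (e \<circ> Const) \<subseteq> e ` ?H" using herbrand.Const by fastforce
    show "inst (e \<circ> Const) \<alpha> \<in> ?F" if "\<alpha> \<in> A" for \<alpha>
    proof -
      have "inst e (inst Const \<alpha>) \<in> ?F" using that by (auto intro: canon.data)
      then show ?thesis by (simp add: map_atom_comp)
    qed
    show "sat_tgd (e ` ?H) ?F t" if t: "t \<in> T" for t
      unfolding sat_tgd_def
    proof (intro allI impI)
      fix s assume s: "range s \<subseteq> e ` ?H" "inst s (body t) \<in> ?F"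
      \<comment> \<open>The copy satisfies \<open>t\<close> because the chase step for the decoded
        assignment can be encoded again.\<close>
      let ?s' = "skolem t (i \<circ> s)"
      have "inst ?s' \<alpha> \<in> canon T A" if "\<alpha> \<in> set (head t)" for \<alpha>
        using t pull[OF s(2)] that by (rule canon.chase)
      then have "\<forall>\<alpha>\<in>set (head t). inst (e \<circ> ?s') \<alpha> \<in> ?F"
        by (metis (no_types, lifting) image_eqI map_atom_comp comp_id)
      moreover have "?s' v \<in> ?H" for v
        using t s(1) i_in by (intro skolem_herbrand) auto
      then have "range (e \<circ> ?s') \<subseteq> e ` ?H" by auto
      moreover have "\<forall>x\<in>args (body t). (e \<circ> ?s') x = s x"
        using s(1) i_in by (auto simp: skolem_def)
      ultimately show "\<exists>s'. range s' \<subseteq> e ` ?H \<and> (\<forall>x\<in>args (body t). s' x = s x) \<and>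
          (\<forall>\<alpha>\<in>set (head t). inst s' \<alpha> \<in> ?F)" by blast
    qed
  qed
  then have "sat (e ` ?H) ?F (e \<circ> Const \<circ> s) (cq Y \<phi>)"
    using ent unfolding entails_def by blast
  then obtain s' where s': "\<forall>x. x \<notin> Y \<longrightarrow> s' x = e (Const (s x))" "\<forall>\<alpha>\<in>\<phi>. inst s' \<alpha> \<in> ?F"
    by (auto simp: sat_cq fin)
  have "cq_hom T A Y \<phi> s (i \<circ> s')"
    unfolding cq_hom_def using s' pull by (auto simp: ie herbrand.Const)
  then show ?thesis by blast
qed

section \<open>Branches of the canonical model\<close>

text \<open>The fresh predicate \<open>None\<close> occurs in no renamed atom and
  \<open>Some\<close> is injective, so facts of the extended structure can be read back.\<close>

lemma map_atom_Some_mem: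
  assumes "map_atom Some s \<alpha> \<in> insert (Unary None a) (map_atom Some id ` M)"
  shows "inst s \<alpha> \<in> M"
proof -
  have "map_atom Some s \<alpha> \<noteq> Unary None a" by (cases \<alpha>) auto
  then obtain \<beta> where "\<beta> \<in> M" "map_atom Some s \<alpha> = map_atom Some id \<beta>" using assms by auto
  moreover from this(2) have "inst s \<alpha> = \<beta>" by (cases \<alpha>; cases \<beta>) auto
  ultimately show ?thesis by simp
qed

lemma body_map_tgd: "body (map_tgd f t) = map_atom f id (body t)"
  by (cases t) (simp add: id_def)

lemma head_map_tgd: "head (map_tgd f t) = map (map_atom f id) (head t)"
  by (cases t) (simp add: id_def)

text \<open>The canonical model of the data, with the fresh fact added at \<open>s z\<close>,
  satisfies the extended ontology. Universality of the generator's canonical model then yields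
  \<open>g\<close>.\<close>

lemma canon_gen_hom:
  assumes "sat (ind A) A s (gen_pe \<rho> z)"
  obtains g where "g (Const ()) = Const (s z)"
    and "\<And>\<alpha>. map_atom Some id \<alpha> \<in> canon_gen T \<rho> \<Longrightarrow> inst g \<alpha> \<in> canon T A"
proof
  let ?a = "Const (s z)"
  let ?F = "insert (Unary None ?a) (map_atom Some id ` canon T A)"
  let ?g = "canon_hom UNIV ?F (\<lambda>_. ?a)"
  show "?g (Const ()) = ?a" by simp
  have old: "sat_tgd UNIV ?F (map_tgd Some t)" if t: "t \<in> T" for t
    unfolding sat_tgd_def
  proof (intro allI impI)
    fix r assume "inst r (body (map_tgd Some t)) \<in> ?F"
    then have "map_atom Some r (body t) \<in> ?F" by (simp add: body_map_tgd map_atom_comp)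
    then have "inst r (body t) \<in> canon T A" by (rule map_atom_Some_mem)
    then have "inst (skolem t r) \<alpha> \<in> canon T A" if "\<alpha> \<in> set (head t)" for \<alpha>
      using that by (rule canon.chase[OF t])
    then have "map_atom Some id (inst (skolem t r) \<alpha>) \<in> ?F" if "\<alpha> \<in> set (head t)" for \<alpha>
      using that by blast
    then show "\<exists>s'. range s' \<subseteq> UNIV \<and> (\<forall>x\<in>args (body (map_tgd Some t)). s' x = r x) \<and>
        (\<forall>\<alpha>\<in>set (head (map_tgd Some t)). inst s' \<alpha> \<in> ?F)"
      by (intro exI[of _ "skolem t r"])
        (auto simp: skolem_def body_map_tgd head_map_tgd map_atom_comp args_map_atom)
  qed
  have fresh: "sat_tgd UNIV ?F (TGD (Unary None 0) [map_atom Some id (gen_atom \<rho> 0 1)])"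
    unfolding sat_tgd_def
  proof (intro allI impI)
    fix r :: "var \<Rightarrow> ('a, const) elem"
    assume "inst r (body (TGD (Unary None 0) [map_atom Some id (gen_atom \<rho> 0 1)])) \<in> ?F"
    moreover have "Unary None (r 0) \<noteq> map_atom Some id \<beta>" for \<beta> :: "('a, ('a, const) elem) atom"
      by (cases \<beta>) auto
    ultimately have r: "r 0 = ?a" by auto
    \<comment> \<open>For \<open>GOut\<close> and \<open>GIn\<close>, \<open>b\<close> is the
      constant that witnesses the existential formula in the data; for the other two forms it is
      arbitrary.\<close>
    obtain b where "inst (\<lambda>v. if v = 0 then s z else b) (gen_atom \<rho> 0 1) \<in> A"
      using assms by (cases \<rho>) auto
    from canon.data[OF this, of T]
    have "inst (r(1 := Const b)) (gen_atom \<rho> 0 1) \<in> canon T A"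
      by (cases \<rho>) (auto simp: r)
    then have "map_atom Some id (inst (r(1 := Const b)) (gen_atom \<rho> 0 1)) \<in> ?F" by blast
    then show "\<exists>s'. range s' \<subseteq> UNIV \<and>
        (\<forall>x\<in>args (body (TGD (Unary None 0) [map_atom Some id (gen_atom \<rho> 0 1)])). s' x = r x) \<and>
        (\<forall>\<alpha>\<in>set (head (TGD (Unary None 0) [map_atom Some id (gen_atom \<rho> 0 1)])). inst s' \<alpha> \<in> ?F)"
      by (intro exI[of _ "r(1 := Const b)"]) (auto simp: map_atom_comp)
  qed
  fix \<alpha> assume "map_atom Some id \<alpha> \<in> canon_gen T \<rho>"
  then have "inst ?g (map_atom Some id \<alpha>) \<in> ?F"
    unfolding canon_gen_def using old fresh
    by (intro canon_hom[rotated 4]) auto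
  then have "map_atom Some ?g \<alpha> \<in> ?F" by (simp add: map_atom_comp)
  then show "inst ?g \<alpha> \<in> canon T A" by (rule map_atom_Some_mem)
qed

text \<open>The child of a constant through which a null descends from that constant: its tgd, its
  existential variable, and the constant.\<close>

fun branch :: "('p, 'c) elem \<Rightarrow> ('p tgd \<times> var \<times> 'c) option" where
  "branch (Null t y [Const a]) = Some (t, y, a)"
| "branch (Null t y [Null t' y' es]) = branch (Null t' y' es)"
| "branch _ = None"

lemma branch_Null: "e \<notin> range Const \<Longrightarrow> branch (Null t y [e]) = branch e"
  by (cases e) auto

text \<open>A binary body is turned into a loop because it is used at the root of a branch. There
  the tgd creates a null, the bound of two variables leaves one body variable, and both arguments
  are the same constant.\<close>

fun body_gen :: "('p, 'a) atom \<Rightarrow> 'p gen" where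
  "body_gen (Unary S x) = GUn S"
| "body_gen (Binary S x y) = GLoop S"

text \<open>All constants are merged into the root \<open>()\<close>, which is harmless on a single
  branch, where only one constant occurs. The tgds stored in nulls are renamed along.\<close>

abbreviation forget :: "('p, 'c) elem \<Rightarrow> ('p option, unit) elem" where
  "forget \<equiv> map_elem Some (\<lambda>_. ())"

lemma forget_skolem: "forget (skolem t s v) = skolem (map_tgd Some t) (forget \<circ> s) v"
  by (simp add: skolem_def body_map_tgd args_map_atom)

text \<open>Since \<open>forget\<close> commutes with \<open>skolem\<close>, a chase step over the
  data is imitated by the renamed tgd below the root of the generator.\<close>

lemma canon_gen_chase:
  assumes "t \<in> T" "\<alpha> \<in> set (head t)"
    and "map_atom Some forget (inst s (body t)) \<in> canon_gen T \<rho>"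
  shows "map_atom Some forget (inst (skolem t s) \<alpha>) \<in> canon_gen T \<rho>"
proof -
  have "inst (forget \<circ> s) (body (map_tgd Some t)) \<in> canon_gen T \<rho>"
    using assms(3) by (simp add: body_map_tgd map_atom_comp)
  then have "inst (skolem (map_tgd Some t) (forget \<circ> s)) (map_atom Some id \<alpha>) \<in> canon_gen T \<rho>"
    unfolding canon_gen_def using assms(1,2) by (intro canon.chase) (auto simp: head_map_tgd)
  moreover have "skolem (map_tgd Some t) (forget \<circ> s) = forget \<circ> skolem t s"
    by (auto simp: forget_skolem)
  ultimately show ?thesis by (simp add: map_atom_comp)
qed

text \<open>This is the first chase step of the generator, by the tgd for the fresh
  predicate.\<close>

lemma canon_gen_root: "map_atom Some (\<lambda>_. Const ()) \<alpha> \<in> canon_gen T (body_gen \<alpha>)"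
proof -
  let ?t = "TGD (Unary None 0) [map_atom Some id (gen_atom (body_gen \<alpha>) 0 1)]"
  let ?T = "map_tgd Some ` T \<union> {?t}"
  have "inst Const (Unary None ()) \<in> canon ?T {Unary None ()}" by (rule canon.data) simp
  then have "inst (skolem ?t (\<lambda>_. Const ())) (map_atom Some id (gen_atom (body_gen \<alpha>) 0 1))
      \<in> canon ?T {Unary None ()}"
    by (intro canon.chase) auto
  then show ?thesis unfolding canon_gen_def by (cases \<alpha>) (auto simp: skolem_def)
qed

text \<open>Bodies are single atoms, so an atom with a null on some branch descends, by a chain of chase
  steps, from the one atom over the constant that created the branch.\<close>

lemma canon_branch:
  assumes T: "ontology T"
  shows "\<beta> \<in> canon T A \<Longrightarrow> e \<in> args \<beta> \<Longrightarrow> e \<notin> range Const \<Longrightarrow>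
    \<exists>t y a. branch e = Some (t, y, a) \<and> t \<in> T \<and> inst (\<lambda>_. Const a) (body t) \<in> canon T A \<and>
      (\<forall>e'\<in>args \<beta>. e' = Const a \<or> branch e' = Some (t, y, a)) \<and>
      map_atom Some forget \<beta> \<in> canon_gen T (body_gen (body t))"
proof (induction arbitrary: e rule: canon.induct)
  case (data \<alpha>)
  then show ?case by (auto simp: args_map_atom)
next
  case (chase t s \<alpha>)
  have card: "card (args (body t) \<union> vars_of (set (head t))) \<le> 2"
    and finv: "finite (args (body t) \<union> vars_of (set (head t)))"
    using T chase.hyps(1) by (auto simp: ontology_def vars_of_def finite_args)
  have sub: "args \<alpha> \<subseteq> vars_of (set (head t))" using chase.hyps(3) by (auto simp: vars_of_def)
  \<comment> \<open>One body variable and one existential variable already exhaust the two that a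
    tgd may have, so a new null has a single argument.\<close>
  have ex_var: "\<exists>u. args (body t) = {u} \<and> args \<alpha> \<subseteq> {u, v} \<and> skolem t s v = Null t v [s u]"
    if v: "v \<in> args \<alpha>" "v \<notin> args (body t)" for v
  proof -
    obtain u where u: "u \<in> args (body t)" by (cases "body t") auto
    have "{u, v} \<subseteq> args (body t) \<union> vars_of (set (head t))" using u v sub by auto
    moreover have "u \<noteq> v" using u v by blast
    then have "card {u, v} = 2" by simp
    ultimately have eq: "args (body t) \<union> vars_of (set (head t)) = {u, v}"
      using card finv by (metis card_seteq)
    then have "args (body t) = {u}" using u v by blast
    then show ?thesis using eq v sub by (auto simp: skolem_def)
  qed
  obtain v where v: "v \<in> args \<alpha>" "e = skolem t s v" using chase.prems(1) by (auto simp: args_map_atom)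
  show ?case
  proof (cases "\<exists>u\<in>args (body t). s u \<notin> range Const")
    \<comment> \<open>A null in the body lies on a branch by induction; the new atom stays on that
      branch, and a null that it creates is a child of \<open>s u\<close>.\<close>
    case True
    then obtain u where u: "u \<in> args (body t)" "s u \<notin> range Const" by blast
    then obtain t1 y1 a1 where IH: "branch (s u) = Some (t1, y1, a1)" "t1 \<in> T"
      "inst (\<lambda>_. Const a1) (body t1) \<in> canon T A"
      "\<forall>e'\<in>args (inst s (body t)). e' = Const a1 \<or> branch e' = Some (t1, y1, a1)"
      "map_atom Some forget (inst s (body t)) \<in> canon_gen T (body_gen (body t1))"
      using chase.IH[of "s u"] by (auto simp: args_map_atom map_atom_ident)
    have all: "skolem t s w = Const a1 \<or> branch (skolem t s w) = Some (t1, y1, a1)"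
      if w: "w \<in> args \<alpha>" for w
    proof (cases "w \<in> args (body t)")
      case True
      then show ?thesis using IH(4) by (auto simp: skolem_def args_map_atom)
    next
      case False
      then have "skolem t s w = Null t w [s u]" using ex_var[OF w False] u(1) by auto
      then show ?thesis using IH(1) u(2) by (simp add: branch_Null)
    qed
    then have "branch e = Some (t1, y1, a1)" using v chase.prems(2) by auto
    moreover have "map_atom Some forget (inst (skolem t s) \<alpha>) \<in> canon_gen T (body_gen (body t1))"
      using chase.hyps(1,3) IH(5) by (rule canon_gen_chase)
    ultimately show ?thesis using IH(2,3) all by (auto simp: args_map_atom map_atom_ident)
  next
    \<comment> \<open>All body values are constants, so \<open>e\<close> is new and hangs directly
      below a constant: this chase step opens the branch.\<close>
    case False
    then have nv: "v \<notin> args (body t)" using v chase.prems(2) by (auto simp: skolem_def)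
    then obtain u where u: "args (body t) = {u}" "args \<alpha> \<subseteq> {u, v}" "e = Null t v [s u]"
      using ex_var v by metis
    then obtain a where a: "s u = Const a" using False by auto
    have root: "inst s (body t) = inst (\<lambda>_. Const a) (body t)"
      using u(1) a by (intro map_atom_cong_args) auto
    have "map_atom Some forget (inst s (body t)) = map_atom Some (\<lambda>_. Const ()) (body t)"
      unfolding root by (simp add: map_atom_comp comp_def)
    then have "map_atom Some forget (inst s (body t)) \<in> canon_gen T (body_gen (body t))"
      by (simp add: canon_gen_root)
    with chase.hyps(1,3)
    have "map_atom Some forget (inst (skolem t s) \<alpha>) \<in> canon_gen T (body_gen (body t))"
      by (rule canon_gen_chase)
    moreover have "branch e = Some (t, v, a)" using u(3) a by simp
    moreover have "skolem t s u = Const a" using u(1) a by (simp add: skolem_def)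
    then have "\<forall>e'\<in>args (inst (skolem t s) \<alpha>). e' = Const a \<or> branch e' = Some (t, v, a)"
      using u(2) v(2) \<open>branch e = Some (t, v, a)\<close> by (auto simp: args_map_atom)
    ultimately show ?thesis using chase.hyps(1,2) root by (auto simp: map_atom_ident)
  qed
qed

section \<open>Tree witnesses\<close>

lemma finite_vars_of: "finite \<phi> \<Longrightarrow> finite (vars_of \<phi>)"
  by (simp add: vars_of_def finite_args)

text \<open>The type \<open>'p\<close> may be infinite, but finitely many predicates occur in
  \<open>T\<close>. Finiteness is what makes \<open>list_of\<close> enumerate the generators in
  \<open>tw\<close>.\<close>

lemma finite_gen_in:
  assumes "finite T"
  shows "finite {\<rho>. gen_in T \<rho>}"
proof -
  let ?S = "\<Union>\<alpha>\<in>tgd_atoms T. atom_preds \<alpha>"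
  have "finite (atom_preds \<alpha>)" for \<alpha> :: "('a, var) atom" by (cases \<alpha>) auto
  moreover have "finite (tgd_atoms T)" using assms by (auto simp: tgd_atoms_def)
  ultimately have "finite ?S" by blast
  moreover have "{\<rho>. gen_in T \<rho>} \<subseteq> GUn ` ?S \<union> GLoop ` ?S \<union> GOut ` ?S \<union> GIn ` ?S"
  proof
    fix \<rho> assume "\<rho> \<in> {\<rho>. gen_in T \<rho>}"
    then show "\<rho> \<in> GUn ` ?S \<union> GLoop ` ?S \<union> GOut ` ?S \<union> GIn ` ?S" by (cases \<rho>) force+
  qed
  ultimately show ?thesis by (meson finite_UnI finite_imageI finite_subset)
qed

lemma finite_tree_witness_by: "finite T \<Longrightarrow> finite {\<rho>. tree_witness_by T Y \<phi> \<rho> t}"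
  by (rule finite_subset[OF _ finite_gen_in]) (auto simp: tree_witness_by_def)

lemma tree_witness_vars:
  assumes "tree_witness T Y \<phi> t"
  shows "fst t \<union> snd t \<subseteq> vars_of \<phi>"
proof -
  have "fst t \<union> snd t = vars_of (q_of \<phi> t)"
    using assms unfolding tree_witness_def tree_witness_by_def tw_hom_def by metis
  then show ?thesis by (auto simp: q_of_def vars_of_def)
qed

lemma finite_tree_witness:
  assumes "finite \<phi>"
  shows "finite {t. tree_witness T Y \<phi> t \<and> z \<in> snd t}"
proof (rule finite_subset)
  show "{t. tree_witness T Y \<phi> t \<and> z \<in> snd t} \<subseteq> Pow (vars_of \<phi>) \<times> Pow (vars_of \<phi>)"
    by (auto dest!: tree_witness_vars)
  show "finite (Pow (vars_of \<phi>) \<times> Pow (vars_of \<phi>))" using finite_vars_of[OF assms] by simp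
qed

lemma sat_gen_pe: "sat D F s (gen_pe \<rho> z) \<longleftrightarrow> sat D F (\<lambda>_. s z) (gen_pe \<rho> 0)"
  by (cases \<rho>) auto

lemma fv_gen_pe: "fv (gen_pe \<rho> z) = {z}"
  by (cases \<rho>) auto

text \<open>The bound variable lies outside the roots, so assigning it does not disturb their
  values. Without roots, \<open>d\<close> can be any element at which the generator holds.\<close>

lemma sat_tw:
  assumes "finite T" "finite (fst t)"
  shows "sat D F s (tw T Y \<phi> t) \<longleftrightarrow>
    (\<exists>\<rho>. tree_witness_by T Y \<phi> \<rho> t \<and>
      (\<exists>d\<in>D. (\<forall>x\<in>fst t. s x = d) \<and> sat D F (\<lambda>_. d) (gen_pe \<rho> 0)))"
proof -
  define z where "z = (LEAST z. z \<notin> fst t)"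
  have "\<exists>z. z \<notin> fst t" using assms(2) ex_new_if_finite[OF infinite_UNIV_nat] by blast
  then have z: "z \<notin> fst t" unfolding z_def by (rule LeastI_ex)
  have gen: "sat D F (s(z := d)) (gen_pe \<rho> z) \<longleftrightarrow> sat D F (\<lambda>_. d) (gen_pe \<rho> 0)" for d \<rho>
    by (subst sat_gen_pe) simp
  have "sat D F (s(z := d)) (Conj (gen_pe \<rho> z # map (\<lambda>x. Eq x z) (list_of (fst t)))) \<longleftrightarrow>
      (\<forall>x\<in>fst t. s x = d) \<and> sat D F (\<lambda>_. d) (gen_pe \<rho> 0)" for d \<rho>
    using list_of[OF assms(2)] z by (auto simp: gen)
  then have "sat D F s (Ex z (Conj (gen_pe \<rho> z # map (\<lambda>x. Eq x z) (list_of (fst t))))) \<longleftrightarrow>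
      (\<exists>d\<in>D. (\<forall>x\<in>fst t. s x = d) \<and> sat D F (\<lambda>_. d) (gen_pe \<rho> 0))" for \<rho>
    by (simp only: sat.simps(5))
  then show ?thesis
    unfolding tw_def Let_def z_def[symmetric]
    using list_of[OF finite_tree_witness_by[OF assms(1), of Y \<phi> t]]
    by (simp del: sat.simps add: sat.simps(4))
qed

text \<open>Two maps are glued: inside the witness, its own homomorphism followed by the map from
  the generator's canonical model; elsewhere \<open>h\<close>. They agree on the roots, where both
  give \<open>Const d\<close>, and an atom outside \<open>q_of \<phi> t\<close> contains no inner
  variable.\<close>

lemma tree_witness_cq_hom:
  assumes tw: "tree_witness_by T Y \<phi> \<rho> t"
    and root: "\<forall>x\<in>fst t. s' x = d" "sat (ind A) A (\<lambda>_. d) (gen_pe \<rho> 0)"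
    and s': "\<forall>x. x \<notin> Y \<inter> fst t \<longrightarrow> s' x = s x"
    and h: "cq_hom T A (Y - Y \<inter> fst t) (\<phi> - q_of \<phi> t) s' h"
  shows "\<exists>h. cq_hom T A Y \<phi> s h"
proof -
  obtain k where k: "tw_hom T Y \<phi> \<rho> t k" using tw unfolding tree_witness_by_def by blast
  obtain g where g: "g (Const ()) = Const d"
    "\<And>\<alpha>. map_atom Some id \<alpha> \<in> canon_gen T \<rho> \<Longrightarrow> inst g \<alpha> \<in> canon T A"
    using canon_gen_hom[OF root(2)] by blast
  define h' where "h' x = (if x \<in> snd t then g (k x) else h x)" for x
  have "inst h' \<alpha> \<in> canon T A" if \<alpha>: "\<alpha> \<in> \<phi>" for \<alpha>
  proof (cases "\<alpha> \<in> q_of \<phi> t")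
    case True
    then have "map_atom Some k \<alpha> \<in> canon_gen T \<rho>" using k unfolding tw_hom_def by blast
    then have "map_atom Some id (inst k \<alpha>) \<in> canon_gen T \<rho>" by (simp add: map_atom_comp)
    then have "inst g (inst k \<alpha>) \<in> canon T A" by (rule g(2))
    moreover have "inst h' \<alpha> = inst (g \<circ> k) \<alpha>"
    proof (rule map_atom_cong_args)
      fix x assume "x \<in> args \<alpha>"
      then have "x \<in> fst t \<union> snd t" using True by (auto simp: q_of_def)
      moreover have "h' x = (g \<circ> k) x" if "x \<in> fst t"
      proof -
        have "k x = Const ()" "x \<notin> snd t" using that k unfolding tw_hom_def by blast+
        moreover have "h x = Const d" using h that root(1) by (simp add: cq_hom_def)
        ultimately show ?thesis using g(1) by (simp add: h'_def)
      qed
      ultimately show "h' x = (g \<circ> k) x" by (auto simp: h'_def)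
    qed
    ultimately show ?thesis by (simp add: map_atom_comp)
  next
    case False
    then have "args \<alpha> \<inter> snd t = {}" using k \<alpha> unfolding tw_hom_def by blast
    then have "inst h' \<alpha> = inst h \<alpha>" by (intro map_atom_cong_args) (auto simp: h'_def)
    then show ?thesis using h \<alpha> False by (auto simp: cq_hom_def)
  qed
  moreover have "h' x = Const (s x)" if "x \<notin> Y" for x
  proof -
    have "x \<notin> snd t" using k that unfolding tw_hom_def by blast
    then show ?thesis using h s' that by (auto simp: cq_hom_def h'_def)
  qed
  ultimately show ?thesis unfolding cq_hom_def by blast
qed

text \<open>The witness is read off from \<open>h\<close>: its interior is the component of
  \<open>z\<close> among the variables sent to nulls, its roots are the neighbours sent to a
  constant, and its homomorphism is \<open>h\<close> followed by \<open>forget\<close>.\<close>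

lemma ex_tree_witness:
  assumes T: "ontology T" and A: "complete_data TYPE('d) T A" and h: "cq_hom T A Y \<phi> s h"
    and z: "z \<in> vars_of \<phi>" "h z \<notin> range Const"
  obtains \<rho> t a where "tree_witness_by T Y \<phi> \<rho> t" "z \<in> snd t" "a \<in> ind A"
    "sat (ind A) A (\<lambda>_. a) (gen_pe \<rho> 0)" "\<forall>x\<in>fst t. h x = Const a"
proof -
  define N where "N v \<longleftrightarrow> h v \<notin> range Const" for v
  define E where "E = {(u, v). \<exists>\<alpha>\<in>\<phi>. u \<in> args \<alpha> \<and> v \<in> args \<alpha> \<and> N u \<and> N v}"
  define C where "C = E\<^sup>* `` {z}"
  have br: "\<exists>t y a. branch (h u) = Some (t, y, a) \<and> t \<in> T \<and>
      inst (\<lambda>_. Const a) (body t) \<in> canon T A \<and>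
      (\<forall>v\<in>args \<alpha>. h v = Const a \<or> branch (h v) = Some (t, y, a)) \<and>
      map_atom Some (forget \<circ> h) \<alpha> \<in> canon_gen T (body_gen (body t))"
    if "\<alpha> \<in> \<phi>" "u \<in> args \<alpha>" "N u" for \<alpha> u
    using canon_branch[OF T, of "inst h \<alpha>" A "h u"] h that
    by (auto simp: cq_hom_def N_def args_map_atom map_atom_comp)
  obtain \<alpha>0 where "\<alpha>0 \<in> \<phi>" "z \<in> args \<alpha>0" using z(1) by (auto simp: vars_of_def)
  then obtain t0 y a where b: "branch (h z) = Some (t0, y, a)" "t0 \<in> T"
    "inst (\<lambda>_. Const a) (body t0) \<in> canon T A"
    using br z(2) N_def by metis
  let ?\<rho> = "body_gen (body t0)"
  have C: "N v \<and> branch (h v) = Some (t0, y, a) \<and> v \<in> vars_of \<phi>" if "v \<in> C" for v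
  proof -
    have "(z, v) \<in> E\<^sup>*" using that by (simp add: C_def)
    then show ?thesis
    proof induction
      case base
      then show ?case using z b by (simp add: N_def)
    next
      case (step u v)
      then obtain \<alpha> where \<alpha>: "\<alpha> \<in> \<phi>" "u \<in> args \<alpha>" "v \<in> args \<alpha>" "N u" "N v" by (auto simp: E_def)
      then have "branch (h v) = Some (t0, y, a)" using br[OF \<alpha>(1,2,4)] step.IH by (auto simp: N_def)
      then show ?case using \<alpha> by (auto simp: vars_of_def)
    qed
  qed
  \<comment> \<open>An atom that meets \<open>C\<close> stays on the branch of \<open>h z\<close>,
    so the component can be left only through variables sent to \<open>a\<close>.\<close>
  have touch: "(\<forall>v\<in>args \<alpha>. (N v \<longrightarrow> v \<in> C) \<and> (\<not> N v \<longrightarrow> h v = Const a)) \<and>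
      map_atom Some (forget \<circ> h) \<alpha> \<in> canon_gen T ?\<rho>"
    if \<alpha>: "\<alpha> \<in> \<phi>" "args \<alpha> \<inter> C \<noteq> {}" for \<alpha>
  proof -
    obtain u where u: "u \<in> args \<alpha>" "u \<in> C" using \<alpha> by blast
    have "v \<in> C" if "v \<in> args \<alpha>" "N v" for v
    proof -
      have "(u, v) \<in> E" using \<alpha>(1) u C that by (auto simp: E_def)
      then show ?thesis using u(2) by (auto simp: C_def)
    qed
    moreover have "h v = Const a" if "v \<in> args \<alpha>" "\<not> N v" for v
    proof -
      have "branch (h v) = None" using that(2) by (auto simp: N_def)
      then show ?thesis using br[OF \<alpha>(1) u(1)] C[OF u(2)] that(1) by auto
    qed
    moreover have "map_atom Some (forget \<circ> h) \<alpha> \<in> canon_gen T ?\<rho>"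
      using br[OF \<alpha>(1) u(1)] C[OF u(2)] by auto
    ultimately show ?thesis by blast
  qed
  define R where "R = {x. \<exists>\<alpha>\<in>\<phi>. args \<alpha> \<inter> C \<noteq> {} \<and> x \<in> args \<alpha> \<and> \<not> N x}"
  let ?t = "(R, C)"
  let ?k = "forget \<circ> h"
  \<comment> \<open>Merging the constants still keeps nulls apart from them, so the preimage of the
    root consists precisely of the variables sent to constants.\<close>
  have k: "?k x = Const () \<longleftrightarrow> \<not> N x" for x
    by (cases "h x") (auto simp: N_def)
  have zC: "z \<in> C" by (simp add: C_def)
  have q: "q_of \<phi> ?t = {\<alpha> \<in> \<phi>. args \<alpha> \<inter> C \<noteq> {}}"
  proof (intro set_eqI iffI)
    fix \<alpha> assume "\<alpha> \<in> q_of \<phi> ?t"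
    then show "\<alpha> \<in> {\<alpha> \<in> \<phi>. args \<alpha> \<inter> C \<noteq> {}}" by (auto simp: q_of_def)
  next
    fix \<alpha> assume "\<alpha> \<in> {\<alpha> \<in> \<phi>. args \<alpha> \<inter> C \<noteq> {}}"
    then have \<alpha>: "\<alpha> \<in> \<phi>" "args \<alpha> \<inter> C \<noteq> {}" by auto
    have "args \<alpha> \<subseteq> R \<union> C" using touch[OF \<alpha>] \<alpha> by (auto simp: R_def)
    moreover have "\<not> args \<alpha> \<subseteq> R" using \<alpha>(2) C by (auto simp: R_def)
    ultimately show "\<alpha> \<in> q_of \<phi> ?t" using \<alpha>(1) by (simp add: q_of_def)
  qed
  have vars_q: "x \<in> vars_of (q_of \<phi> ?t) \<longleftrightarrow> x \<in> R \<union> C" for x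
  proof
    assume "x \<in> vars_of (q_of \<phi> ?t)"
    then show "x \<in> R \<union> C" by (auto simp: vars_of_def q_of_def)
  next
    assume "x \<in> R \<union> C"
    then show "x \<in> vars_of (q_of \<phi> ?t)"
    proof
      assume "x \<in> C"
      then show ?thesis using C[of x] unfolding q by (auto simp: vars_of_def)
    next
      assume "x \<in> R"
      then obtain \<alpha> where "\<alpha> \<in> \<phi>" "args \<alpha> \<inter> C \<noteq> {}" "x \<in> args \<alpha>" unfolding R_def by blast
      then show ?thesis unfolding q vars_of_def by blast
    qed
  qed
  have hom: "tw_hom T Y \<phi> ?\<rho> ?t ?k"
    unfolding tw_hom_def fst_conv snd_conv
  proof (intro conjI)
    show "R \<inter> C = {}" using C by (auto simp: R_def)
    show "C \<noteq> {}" using zC by blast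
    show "C \<subseteq> Y" using C h by (auto simp: cq_hom_def N_def)
    show "R \<union> C = vars_of (q_of \<phi> ?t)" using vars_q by blast
    show "map_atom Some ?k ` q_of \<phi> ?t \<subseteq> canon_gen T ?\<rho>" using touch by (auto simp: q)
    show "R = {x \<in> vars_of (q_of \<phi> ?t). ?k x = Const ()}"
      unfolding k vars_q using C by (auto simp: R_def)
    show "\<forall>\<alpha>\<in>\<phi>. args \<alpha> \<inter> C \<noteq> {} \<longrightarrow> \<alpha> \<in> q_of \<phi> ?t" by (auto simp: q)
  qed
  \<comment> \<open>A competitor for the same map has a nonempty interior of variables sent to
    nulls, closed under \<open>E\<close>. If its atoms are among those of the witness, this interior
    meets the component \<open>C\<close>, hence contains it, and no atom can be missing.\<close>
  have minimal: "\<not> (\<exists>t'. tw_hom T Y \<phi> ?\<rho> t' ?k \<and> q_of \<phi> t' \<subset> q_of \<phi> ?t)"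
  proof
    assume "\<exists>t'. tw_hom T Y \<phi> ?\<rho> t' ?k \<and> q_of \<phi> t' \<subset> q_of \<phi> ?t"
    then obtain t' where t': "tw_hom T Y \<phi> ?\<rho> t' ?k" and less: "q_of \<phi> t' \<subset> q_of \<phi> ?t" by blast
    have vars_t': "fst t' \<inter> snd t' = {}" "fst t' \<union> snd t' = vars_of (q_of \<phi> t')"
      "fst t' = {x \<in> vars_of (q_of \<phi> t'). \<not> N x}"
      using t' unfolding tw_hom_def k by fast+
    have snd_t': "x \<in> snd t' \<longleftrightarrow> x \<in> vars_of (q_of \<phi> t') \<and> N x" for x
      using vars_t' by blast
    have all: "\<alpha> \<in> q_of \<phi> t'" if "\<alpha> \<in> \<phi>" "args \<alpha> \<inter> snd t' \<noteq> {}" for \<alpha>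
      using t' that unfolding tw_hom_def by blast
    have "snd t' \<noteq> {}" using t' unfolding tw_hom_def by simp
    then obtain u where u: "u \<in> snd t'" by blast
    have "vars_of (q_of \<phi> t') \<subseteq> vars_of (q_of \<phi> ?t)" using less unfolding vars_of_def by blast
    then have "u \<in> R \<union> C" using u snd_t' vars_q by blast
    then have "u \<in> C" using u snd_t' by (auto simp: R_def)
    have "sym E" by (auto simp: E_def sym_def)
    then have "(u, z) \<in> E\<^sup>*" using \<open>u \<in> C\<close> by (auto simp: C_def dest: sym_rtrancl symD)
    have "w \<in> snd t'" if "(u, w) \<in> E\<^sup>*" for w
      using that
    proof induction
      case (step v w)
      then obtain \<alpha> where \<alpha>: "\<alpha> \<in> \<phi>" "v \<in> args \<alpha>" "w \<in> args \<alpha>" "N w" by (auto simp: E_def)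
      then have "\<alpha> \<in> q_of \<phi> t'" using step.IH all by blast
      then show ?case using \<alpha>(3,4) unfolding snd_t' vars_of_def by blast
    qed (rule u)
    then have "C \<subseteq> snd t'" using \<open>(u, z) \<in> E\<^sup>*\<close> by (auto simp: C_def intro: rtrancl_trans)
    then have "q_of \<phi> ?t \<subseteq> q_of \<phi> t'" using all by (auto simp: q)
    then show False using less by blast
  qed
  \<comment> \<open>The atom that opened the branch has no nulls, so completeness puts it into the
    data, and the generator holds at \<open>a\<close>.\<close>
  have "inst Const (inst (\<lambda>_. a) (body t0)) \<in> canon T A"
    using b(3) by (simp add: map_atom_comp map_atom_ident comp_def)
  then have body: "inst (\<lambda>_. a) (body t0) \<in> A" by (rule complete_data_canon[OF A])
  have "body t0 \<in> tgd_atoms T" using b(2) by (auto simp: tgd_atoms_def)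
  then have "gen_in T ?\<rho>" by (cases "body t0") auto
  then have "tree_witness_by T Y \<phi> ?\<rho> ?t"
    unfolding tree_witness_by_def using hom minimal by blast
  moreover have "a \<in> ind A" using body by (cases "body t0") (force simp: vars_of_def)+
  moreover have "sat (ind A) A (\<lambda>_. a) (gen_pe ?\<rho> 0)" using body by (cases "body t0") auto
  moreover have "\<forall>x\<in>fst ?t. h x = Const a" using touch by (auto simp: R_def)
  ultimately show thesis using that zC by (metis snd_conv)
qed

section \<open>The rewriting\<close>

lemma is_decomp_finite:
  assumes "is_decomp Y \<phi> P" "finite Y" "finite \<phi>"
  shows "finite P" and "p \<in> P \<Longrightarrow> finite (fst p) \<and> finite (snd p)"
proof -
  have sub: "fst p \<subseteq> Y \<and> snd p \<subseteq> \<phi>" if "p \<in> P" for p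
    using assms(1) that unfolding is_decomp_def by blast
  then show "p \<in> P \<Longrightarrow> finite (fst p) \<and> finite (snd p)"
    using assms(2,3) finite_subset by metis
  have "P \<subseteq> Pow Y \<times> Pow \<phi>" using sub by (force simp: mem_Times_iff)
  moreover have "finite (Pow Y \<times> Pow \<phi>)" using assms(2,3) by simp
  ultimately show "finite P" by (rule finite_subset)
qed

text \<open>The part that owns \<open>x\<close> must contain every atom with \<open>x\<close>; as
  the atom sets of the parts are disjoint, it is \<open>p\<close>.\<close>

lemma is_decomp_vars:
  assumes "is_decomp Y \<phi> P" "p \<in> P" "\<alpha> \<in> snd p" "x \<in> args \<alpha>" "x \<in> Y"
  shows "x \<in> fst p"
proof -
  obtain p' where p': "p' \<in> P" "x \<in> fst p'" using assms(1,5) unfolding is_decomp_def by blast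
  moreover have "\<alpha> \<in> \<phi>" using assms(1-3) unfolding is_decomp_def by blast
  ultimately have "\<alpha> \<in> snd p'" using assms(1,4) unfolding is_decomp_def by blast
  then have "p' = p" using assms(1-3) p'(1) unfolding is_decomp_def by blast
  then show ?thesis using p'(2) by simp
qed

text \<open>Different parts share no quantified variable, so homomorphisms for them can be
  restricted and glued freely.\<close>

lemma is_decomp_cq_hom:
  assumes P: "is_decomp Y \<phi> P"
  shows "(\<exists>h. cq_hom T A Y \<phi> s h) \<longleftrightarrow> (\<forall>p\<in>P. \<exists>h. cq_hom T A (fst p) (snd p) s h)"
proof
  assume "\<exists>h. cq_hom T A Y \<phi> s h"
  then obtain h where h: "cq_hom T A Y \<phi> s h" ..
  show "\<forall>p\<in>P. \<exists>h. cq_hom T A (fst p) (snd p) s h"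
  proof
    fix p assume p: "p \<in> P"
    let ?h = "\<lambda>x. if x \<in> fst p then h x else Const (s x)"
    have "inst ?h \<alpha> \<in> canon T A" if \<alpha>: "\<alpha> \<in> snd p" for \<alpha>
    proof -
      have "inst ?h \<alpha> = inst h \<alpha>"
        using is_decomp_vars[OF P p \<alpha>] h unfolding cq_hom_def by (intro map_atom_cong_args) metis
      moreover have "\<alpha> \<in> \<phi>" using P p \<alpha> unfolding is_decomp_def by blast
      ultimately show ?thesis using h by (simp add: cq_hom_def)
    qed
    then show "\<exists>h. cq_hom T A (fst p) (snd p) s h"
      by (intro exI[of _ ?h]) (simp add: cq_hom_def)
  qed
next
  assume "\<forall>p\<in>P. \<exists>h. cq_hom T A (fst p) (snd p) s h"
  then obtain H where H: "\<And>p. p \<in> P \<Longrightarrow> cq_hom T A (fst p) (snd p) s (H p)" by metis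
  \<comment> \<open>Disjointness makes the selected part the only one that contains
    \<open>x\<close>.\<close>
  let ?h = "\<lambda>x. if x \<in> Y then H (SOME p. p \<in> P \<and> x \<in> fst p) x else Const (s x)"
  have cover: "\<Union>(fst ` P) = Y" "\<Union>(snd ` P) = \<phi>" using P unfolding is_decomp_def by simp_all
  have part: "(SOME p. p \<in> P \<and> x \<in> fst p) = p" if "p \<in> P" "x \<in> fst p" for p x
    using that P unfolding is_decomp_def by (intro some_equality) blast+
  have "inst ?h \<alpha> \<in> canon T A" if "\<alpha> \<in> \<phi>" for \<alpha>
  proof -
    obtain p where p: "p \<in> P" "\<alpha> \<in> snd p" using \<open>\<alpha> \<in> \<phi>\<close> cover(2) by blast
    have "fst p \<subseteq> Y" using p(1) cover(1) by blast
    have "inst ?h \<alpha> = inst (H p) \<alpha>"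
    proof (rule map_atom_cong_args)
      fix x assume x: "x \<in> args \<alpha>"
      show "?h x = H p x"
      proof (cases "x \<in> Y")
        case True
        then show ?thesis using part[OF p(1)] is_decomp_vars[OF P p x] by simp
      next
        case False
        then have "x \<notin> fst p" using \<open>fst p \<subseteq> Y\<close> by blast
        then show ?thesis using H[OF p(1)] False by (simp add: cq_hom_def)
      qed
    qed
    then show ?thesis using H[OF p(1)] p(2) by (simp add: cq_hom_def)
  qed
  then show "\<exists>h. cq_hom T A Y \<phi> s h" by (intro exI[of _ ?h]) (simp add: cq_hom_def)
qed

lemma cq_hom_fix_var:
  assumes "cq_hom T A (Y - {z}) \<phi> (s(z := d)) h" "z \<in> Y"
  shows "cq_hom T A Y \<phi> s h"
  using assms unfolding cq_hom_def by (metis DiffD1 fun_upd_other)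

lemma list_all2_ball1: "list_all2 R xs ys \<Longrightarrow> x \<in> set xs \<Longrightarrow> \<exists>y. (x, y) \<in> set (zip xs ys) \<and> R x y"
  by (induction rule: list_all2_induct) auto

lemma list_all2_zip: "list_all2 R xs ys \<Longrightarrow> (x, y) \<in> set (zip xs ys) \<Longrightarrow> R x y \<and> x \<in> set xs"
  by (induction rule: list_all2_induct) auto

lemma list_all2_ball2: "list_all2 R xs ys \<Longrightarrow> y \<in> set ys \<Longrightarrow> \<exists>x\<in>set xs. R x y"
  by (induction rule: list_all2_induct) auto

lemma fv_tw:
  assumes "finite T" "finite (fst t)"
  shows "fv (tw T Y \<phi> t) \<subseteq> fst t"
  using list_of[OF finite_tree_witness_by[OF assms(1)]] list_of[OF assms(2)]
  by (auto simp: tw_def Let_def fv_gen_pe)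

lemma fv_Exs: "finite Y \<Longrightarrow> fv (Exs Y \<psi>) = fv \<psi> - Y"
proof -
  have "fv (foldr Ex xs \<psi>) = fv \<psi> - set xs" for xs by (induction xs) auto
  then show "finite Y \<Longrightarrow> fv (Exs Y \<psi>) = fv \<psi> - Y" by (simp add: Exs_def list_of)
qed

text \<open>The roots in \<open>Y\<close> are bound by the block of quantifiers around
  \<open>tw\<close>, and the remaining ones occur in \<open>\<phi>\<close>, so \<open>tw\<close>
  contributes no foreign variable.\<close>

lemma fv_dagger:
  assumes T: "finite T"
  shows "dagger T Y \<phi> \<psi> \<Longrightarrow> finite Y \<Longrightarrow> finite \<phi> \<Longrightarrow> fv \<psi> \<subseteq> vars_of \<phi> - Y"
    and "dagger_part T Y \<phi> \<psi> \<Longrightarrow> finite Y \<Longrightarrow> finite \<phi> \<Longrightarrow> fv \<psi> \<subseteq> vars_of \<phi> - Y"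
proof (induction rule: dagger_dagger_part.inducts)
  case (dagger Y \<phi> P \<psi>s)
  have P: "is_decomp Y \<phi> P" using dagger.hyps(1) by (simp add: finest_decomp_def)
  note fin = is_decomp_finite[OF P dagger.prems]
  have "fv \<psi> \<subseteq> vars_of \<phi> - Y" if \<psi>: "\<psi> \<in> set \<psi>s" for \<psi>
  proof -
    obtain p where p: "p \<in> P" "fv \<psi> \<subseteq> vars_of (snd p) - fst p"
      using list_all2_ball2[OF dagger.IH \<psi>] list_of[OF fin(1)] fin(2) by auto
    have "snd p \<subseteq> \<phi>" using P p(1) unfolding is_decomp_def by blast
    then show ?thesis using p(2) is_decomp_vars[OF P p(1)] by (fastforce simp: vars_of_def)
  qed
  then show ?case by auto
next
  case (part_ground \<phi>)
  then show ?case by (auto simp: list_of vars_of_def)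
next
  case (part_ex z Y \<phi> \<psi> ts \<chi>s)
  have ts: "set ts = {t. tree_witness T Y \<phi> t \<and> z \<in> snd t}"
    using list_of[OF finite_tree_witness[OF part_ex.prems(2)]] part_ex(4) by simp
  have "fv (Exs (Y \<inter> fst t) (Conj [\<chi>, tw T Y \<phi> t])) \<subseteq> vars_of \<phi> - Y"
    if "(t, \<chi>) \<in> set (zip ts \<chi>s)" for t \<chi>
  proof -
    have \<chi>: "fv \<chi> \<subseteq> vars_of (\<phi> - q_of \<phi> t) - (Y - Y \<inter> fst t)" and t: "t \<in> set ts"
      using list_all2_zip[OF part_ex(5) that] part_ex.prems by auto
    have sub: "fst t \<subseteq> vars_of \<phi>" using t tree_witness_vars unfolding ts by blast
    then have "finite (fst t)" using finite_vars_of[OF part_ex.prems(2)] finite_subset by blast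
    then have "fv (tw T Y \<phi> t) \<subseteq> fst t" by (rule fv_tw[OF T])
    moreover have "vars_of (\<phi> - q_of \<phi> t) \<subseteq> vars_of \<phi>" by (auto simp: vars_of_def)
    ultimately show ?thesis using \<chi> sub part_ex.prems(1) by (auto simp: fv_Exs)
  qed
  moreover have "fv (Ex z \<psi>) \<subseteq> vars_of \<phi> - Y" using part_ex(3) part_ex.prems by auto
  ultimately show ?case by fastforce
qed

text \<open>Simultaneous induction, with \<open>s\<close> general because quantifiers change it. The
  first disjunct supplies a constant for \<open>z\<close>; a tree witness disjunct supplies a
  homomorphism for the remaining atoms, to be extended over the witness.\<close>

lemma dagger_sound:
  assumes T: "finite T"
  shows "dagger T Y \<phi> \<psi> \<Longrightarrow> finite Y \<Longrightarrow> finite \<phi> \<Longrightarrow>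
      sat (ind A) A s \<psi> \<Longrightarrow> \<exists>h. cq_hom T A Y \<phi> s h"
    and "dagger_part T Y \<phi> \<psi> \<Longrightarrow> finite Y \<Longrightarrow> finite \<phi> \<Longrightarrow>
      sat (ind A) A s \<psi> \<Longrightarrow> \<exists>h. cq_hom T A Y \<phi> s h"
proof (induction arbitrary: s and s rule: dagger_dagger_part.inducts)
  case (dagger Y \<phi> P \<psi>s)
  have P: "is_decomp Y \<phi> P" using dagger.hyps(1) by (simp add: finest_decomp_def)
  note fin = is_decomp_finite[OF P dagger.prems(1,2)]
  have "\<exists>h. cq_hom T A (fst p) (snd p) s h" if p: "p \<in> P" for p
  proof -
    have "p \<in> set (list_of P)" using p list_of[OF fin(1)] by blast
    from list_all2_ball1[OF dagger.IH this] show ?thesis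
      using fin(2)[OF p] dagger.prems(3) set_zip_rightD by fastforce
  qed
  then show ?case using is_decomp_cq_hom[OF P] by blast
next
  case (part_ground \<phi>)
  have "inst (\<lambda>x. Const (s x)) \<alpha> \<in> canon T A" if "\<alpha> \<in> \<phi>" for \<alpha>
  proof -
    have "inst s \<alpha> \<in> A" using part_ground that by (simp add: list_of)
    from canon.data[OF this, of T] show ?thesis by (simp add: map_atom_comp map_atom_ident comp_def)
  qed
  then show ?case by (intro exI[of _ "\<lambda>x. Const (s x)"]) (simp add: cq_hom_def)
next
  case (part_ex z Y \<phi> \<psi> ts \<chi>s)
  have ts: "set ts = {t. tree_witness T Y \<phi> t \<and> z \<in> snd t}"
    using list_of[OF finite_tree_witness[OF part_ex.prems(2)]] part_ex(4) by simp
  from part_ex.prems(3) consider "sat (ind A) A s (Ex z \<psi>)"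
    | t \<chi> where "(t, \<chi>) \<in> set (zip ts \<chi>s)"
        "sat (ind A) A s (Exs (Y \<inter> fst t) (Conj [\<chi>, tw T Y \<phi> t]))"
    by (fastforce simp del: sat.simps(5))
  then show ?case
  proof cases
    case 1
    then obtain d where "sat (ind A) A (s(z := d)) \<psi>" by auto
    then obtain h where "cq_hom T A (Y - {z}) \<phi> (s(z := d)) h"
      using part_ex(3) part_ex.prems(1,2) by blast
    then show ?thesis using cq_hom_fix_var part_ex.hyps(1) by blast
  next
    case 2
    have t: "t \<in> set ts" by (rule set_zip_leftD[OF 2(1)])
    have "fst t \<subseteq> vars_of \<phi>" using t tree_witness_vars unfolding ts by blast
    then have fint: "finite (fst t)" using finite_vars_of[OF part_ex.prems(2)] finite_subset by blast
    obtain s' where s': "\<forall>x. x \<notin> Y \<inter> fst t \<longrightarrow> s' x = s x" "sat (ind A) A s' \<chi>"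
      "sat (ind A) A s' (tw T Y \<phi> t)"
      using 2(2) part_ex.prems(1) by (auto simp: sat_Exs)
    obtain h where h: "cq_hom T A (Y - Y \<inter> fst t) (\<phi> - q_of \<phi> t) s' h"
      using list_all2_zip[OF part_ex(5) 2(1)] part_ex.prems(1,2) s'(2) by blast
    from T s'(3) fint obtain \<rho> d where "tree_witness_by T Y \<phi> \<rho> t" "\<forall>x\<in>fst t. s' x = d"
      "sat (ind A) A (\<lambda>_. d) (gen_pe \<rho> 0)"
      by (auto simp: sat_tw)
    then show ?thesis using s'(1) h by (rule tree_witness_cq_hom)
  qed
qed

text \<open>Here the homomorphism decides which disjunct holds: the tree witness around
  \<open>z\<close> if \<open>z\<close> occurs in an atom and is sent to a null, the first one
  otherwise.\<close>

lemma dagger_complete: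
  assumes T: "ontology T" and A: "complete_data TYPE('d) T A" "ind A \<noteq> {}"
  shows "dagger T Y \<phi> \<psi> \<Longrightarrow> finite Y \<Longrightarrow> finite \<phi> \<Longrightarrow>
      cq_hom T A Y \<phi> s h \<Longrightarrow> sat (ind A) A s \<psi>"
    and "dagger_part T Y \<phi> \<psi> \<Longrightarrow> finite Y \<Longrightarrow> finite \<phi> \<Longrightarrow>
      cq_hom T A Y \<phi> s h \<Longrightarrow> sat (ind A) A s \<psi>"
proof (induction arbitrary: s h and s h rule: dagger_dagger_part.inducts)
  case (dagger Y \<phi> P \<psi>s)
  have P: "is_decomp Y \<phi> P" using dagger.hyps(1) by (simp add: finest_decomp_def)
  note fin = is_decomp_finite[OF P dagger.prems(1,2)]
  have "sat (ind A) A s \<psi>" if \<psi>: "\<psi> \<in> set \<psi>s" for \<psi>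
  proof -
    obtain p where p: "p \<in> P" "\<And>h. cq_hom T A (fst p) (snd p) s h \<Longrightarrow> sat (ind A) A s \<psi>"
      using list_all2_ball2[OF dagger.IH \<psi>] list_of[OF fin(1)] fin(2) by blast
    then show ?thesis using is_decomp_cq_hom[OF P, of T A s] dagger.prems(3) by blast
  qed
  then show ?case by simp
next
  case (part_ground \<phi>)
  have "inst s \<alpha> \<in> A" if "\<alpha> \<in> \<phi>" for \<alpha>
  proof (rule complete_data_canon[OF A(1)])
    have "h = Const \<circ> s" using part_ground(3) by (auto simp: cq_hom_def)
    moreover have "inst h \<alpha> \<in> canon T A" using part_ground(3) that by (simp add: cq_hom_def)
    ultimately show "inst Const (inst s \<alpha>) \<in> canon T A" by (simp add: map_atom_comp)
  qed
  then show ?case using part_ground by (simp add: list_of)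
next
  case (part_ex z Y \<phi> \<psi> ts \<chi>s)
  have ts: "set ts = {t. tree_witness T Y \<phi> t \<and> z \<in> snd t}"
    using list_of[OF finite_tree_witness[OF part_ex.prems(2)]] part_ex(4) by simp
  note h = part_ex.prems(3)
  show ?case
  proof (cases "z \<in> vars_of \<phi> \<and> h z \<notin> range Const")
    case False
    obtain d where d: "d \<in> ind A" "z \<in> vars_of \<phi> \<longrightarrow> h z = Const d"
    proof (cases "z \<in> vars_of \<phi>")
      case True
      then obtain d where hz: "h z = Const d" using False by auto
      obtain \<alpha> where "\<alpha> \<in> \<phi>" "z \<in> args \<alpha>" using True by (auto simp: vars_of_def)
      then have "d \<in> ind A"
        using canon_constants[of "inst h \<alpha>" T A d] h hz by (force simp: cq_hom_def args_map_atom)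
      then show ?thesis using that hz by blast
    next
      \<comment> \<open>No atom contains \<open>z\<close>, so any constant can serve as the value of
        its quantifier; this is where \<open>ind A\<close> has to be nonempty.\<close>
      case False
      then show ?thesis using that A(2) by blast
    qed
    have "inst (h(z := Const d)) \<alpha> = inst h \<alpha>" if "\<alpha> \<in> \<phi>" for \<alpha>
      using d(2) that by (intro map_atom_cong_args) (auto simp: vars_of_def)
    then have "cq_hom T A (Y - {z}) \<phi> (s(z := d)) (h(z := Const d))"
      using h by (auto simp: cq_hom_def)
    then have "sat (ind A) A (s(z := d)) \<psi>" using part_ex(3) part_ex.prems(1,2) by blast
    then show ?thesis using d(1) by auto
  next
    case True
    then obtain \<rho> t a where t: "tree_witness_by T Y \<phi> \<rho> t" "z \<in> snd t" and a: "a \<in> ind A"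
      "sat (ind A) A (\<lambda>_. a) (gen_pe \<rho> 0)" "\<forall>x\<in>fst t. h x = Const a"
      using ex_tree_witness[OF T A(1) h] by metis
    have tree: "tree_witness T Y \<phi> t" using t(1) by (auto simp: tree_witness_def)
    then have "t \<in> set ts" using t(2) by (simp add: ts)
    then obtain \<chi> where zip: "(t, \<chi>) \<in> set (zip ts \<chi>s)" using list_all2_ball1[OF part_ex(5)] by blast
    have fint: "finite (fst t)"
      using tree_witness_vars[OF tree] finite_vars_of[OF part_ex.prems(2)] finite_subset by blast
    \<comment> \<open>The quantified roots become pinned variables with value \<open>a\<close>, in
      accordance with \<open>h\<close>, so \<open>h\<close> itself serves for the atoms left
      over.\<close>
    define s' where "s' x = (if x \<in> Y \<inter> fst t then a else s x)" for x
    have hs': "h x = Const (s' x)" if "x \<notin> Y \<or> x \<in> fst t" for x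
      using h a(3) that by (auto simp: cq_hom_def s'_def)
    then have "cq_hom T A (Y - Y \<inter> fst t) (\<phi> - q_of \<phi> t) s' h"
      using h by (auto simp: cq_hom_def)
    then have "sat (ind A) A s' \<chi>"
      using list_all2_zip[OF part_ex(5) zip] part_ex.prems(1,2) by blast
    moreover have "\<forall>x\<in>fst t. s' x = a" using hs' a(3) by fastforce
    then have "sat (ind A) A s' (tw T Y \<phi> t)"
      using T fint t(1) a(1,2) by (auto simp: sat_tw ontology_def)
    ultimately have "sat (ind A) A s (Exs (Y \<inter> fst t) (Conj [\<chi>, tw T Y \<phi> t]))"
      using part_ex.prems(1) a(1) by (auto simp: sat_Exs s'_def intro!: exI[of _ s'])
    then show ?thesis using zip by (fastforce simp del: sat.simps(5))
  qed
qed

theorem theorem19: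
  fixes T :: "'p tgd set"
    and X Y :: "var set"
    and \<phi> :: "('p, var) atom set"
    and q_dagger :: "'p pe"
  assumes "infinite (UNIV :: 'd set)"
    and "ontology T"
    and "is_cq X Y \<phi>"
    and "dagger T Y \<phi> q_dagger"
  shows "PE_rewriting_complete TYPE('d) T X (cq Y \<phi>) q_dagger"
proof -
  have T: "finite T" using assms(2) by (simp add: ontology_def)
  have q: "finite Y" "finite \<phi>" "\<phi> \<noteq> {}" "vars_of \<phi> \<subseteq> X \<union> Y" using assms(3) by (auto simp: is_cq_def)
  have "entails TYPE('d) T A s (cq Y \<phi>) \<longleftrightarrow> sat (ind A) A s q_dagger"
    if A: "complete_data TYPE('d) T A" for A s
  proof
    assume "entails TYPE('d) T A s (cq Y \<phi>)"
    then obtain h where h: "cq_hom T A Y \<phi> s h" using entails_cq_hom[OF assms(1) T q(1,2)] by blast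
    \<comment> \<open>The query has an atom, so the canonical model is nonempty; the chase creates
      nothing from empty data, hence there is a constant.\<close>
    obtain \<alpha> where "\<alpha> \<in> canon T A" using h q(3) by (auto simp: cq_hom_def)
    then have "A \<noteq> {}" by (induction) auto
    moreover have "args \<alpha> \<noteq> {}" for \<alpha> :: "('p, const) atom" by (cases \<alpha>) auto
    ultimately have "ind A \<noteq> {}" by (auto simp: vars_of_def)
    then show "sat (ind A) A s q_dagger"
      using dagger_complete(1)[OF assms(2) A _ assms(4) q(1,2) h] by blast
  next
    assume "sat (ind A) A s q_dagger"
    then show "entails TYPE('d) T A s (cq Y \<phi>)"
      using dagger_sound(1)[OF T assms(4) q(1,2)] cq_hom_entails[OF q(1,2)] by blast
  qed
  moreover have "fv q_dagger \<subseteq> X" using fv_dagger(1)[OF T assms(4) q(1,2)] q(4) by blast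
  ultimately show ?thesis unfolding PE_rewriting_complete_def by blast
qed

end
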